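(* Let $g\ge2$, let $U=(I_1,\dots,I_{g+1},V_1,\dots,V_{g+1})\in\mathcal U$ be such that the spectral curve $\gamma$ is nonsingular, and let $P_1,\dots,P_g\in\gamma$ be the points given by the eigenvector map at $U$. Assume that these points $P_i=(p_i,q_i)$ are in generic position, i.e. $p_i\ne0$ for all $i$ and $p_i\neq p_j$ for $i\ne j$. Let $h_1$ be a rational function in $L(P_\infty'+2D^\ast)$. Then the curve $\kappa_1=(h_1(u,v)=0)$ passing through the points $A=\bigl(0,\prod_{i=1}^{g+1}V_i-\prod_{i=1}^{g+1}I_i\bigr)$ and $P_1,P_2,\dots,P_g$ is given (uniquely, i.e. up to multiplying $h_1$ by a nonzero constant) by $$h_1(u,v)=\begin{cases}\displaystyle\sum_{i=0}^g s_1(c_i)u^i+u^{g+1}-v& g\text{ even},\\[2mm] \displaystyle\sum_{i=0}^g t_{g+1}(c_i)u^i+u^{g+1}+v& g\text{ odd}.\end{cases}$$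
   Context: Phase space: $\mathcal U=\{(I_1,\dots,I_{g+1},V_1,\dots,V_{g+1})\in\mathbb C^{2g+2}: 0<\prod V_i<\prod I_i\}$; indices mod $g+1$. Lax matrix of the periodic discrete Toda lattice: $L=(l_{ij})$ is the $(g+1)\times(g+1)$ matrix, depending on a parameter $y$, with diagonal entries $l_{ii}=I_{i+1}+V_i$ (so $l_{g+1,g+1}=I_1+V_{g+1}$), superdiagonal entries $1$, subdiagonal entries $l_{i,i-1}=I_iV_i$ ($i=2,\dots,g+1$), upper-right corner $(-1)^gI_1V_1/y$, lower-left corner $(-1)^gy$, all other entries $0$. One has $\tilde f(x,y):=y\det(x\,\mathrm{Id}+L)=y^2+y(x^{g+1}+c_gx^g+\cdots+c_1x+c_0)+c_{-1}$, which defines polynomials $c_{-1},\dots,c_g$ in the $I_i,V_i$ (in particular $c_{-1}=\prod I_iV_i$, $c_0=\prod I_i+\prod V_i$, $c_g=\sum(I_i+V_i)$). $s_1(c_i)$ denotes the polynomial $c_i$ with $I_1$ replaced by $-I_1$; $t_{g+1}(c_i)$ denotes $c_i$ with $V_{g+1}$ replaced by $-V_{g+1}$. Spectral curve: $\gamma$ is the smooth completion of the affine curve $v^2=(u^{g+1}+c_gu^g+\cdots+c_0)^2-4c_{-1}$ in $\mathbb C^2_{(u,v)}$ with two points at infinity $P_\infty$ (where $v/u^{g+1}\to1$) and $P_\infty'$ (where $v/u^{g+1}\to-1$). The map $\rho(x,y)=(x,\,y-c_{-1}/y)$ sends the curve $\tilde f=0$ to $\gamma$. Eigenvector map: for $i=1,\dots,g$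 let $\varphi_i(x,y)$ be the determinant of the $g\times g$ matrix obtained from the upper-left $g\times g$ block of $x\,\mathrm{Id}+L$ by replacing its $i$-th column by $(l_{1,g+1},\dots,l_{g,g+1})^T$. There are exactly $g$ points $\tilde P_1,\dots,\tilde P_g$ (with multiplicity) satisfying $\varphi_1=\varphi_2=0$; they lie on $\tilde f=0$ and their $x$-coordinates are the roots of the determinant of the upper-left $g\times g$ block of $x\,\mathrm{Id}+L$. Put $P_i=\rho(\tilde P_i)\in\gamma$. $D^\ast=\frac g2(P_\infty+P'_\infty)$ for $g$ even, $D^\ast=\frac{g-1}2(P_\infty+P_\infty')+P_\infty$ for $g$ odd; $L(D)=\{k\in\mathbb C(\gamma)^\times:(k)+D\ge0\}\cup\{0\}$. *)

theory Defs
  imports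
    "Jordan_Normal_Form.Char_Poly"
    "HOL-Computational_Algebra.Computational_Algebra"
    "HOL-Computational_Algebra.Field_as_Ring"
    "HOL-Library.Poly_Mapping"
begin

text \<open>
  A point of phase space is a pair \<open>(I, V)\<close> of functions of which only the values at
  \<open>1, \<dots>, g + 1\<close> matter. The inequalities between complex numbers include the claim that
  both products are real.
\<close>

definition phase_space :: "nat \<Rightarrow> ((nat \<Rightarrow> complex) \<times> (nat \<Rightarrow> complex)) set" where
  "phase_space g = {(I, V).
     (\<Prod>i=1..g+1. V i) \<in> \<real> \<and> (\<Prod>i=1..g+1. I i) \<in> \<real> \<and>
     0 < Re (\<Prod>i=1..g+1. V i) \<and> Re (\<Prod>i=1..g+1. V i) < Re (\<Prod>i=1..g+1. I i)}"

text \<open>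
  The entries are taken in an arbitrary commutative ring, with \<open>z\<close> standing for \<open>1/y\<close>:
  the matrix is used both over the complex numbers and over a ring of Laurent series in \<open>y\<close>.
\<close>

definition lax_entry ::
  "nat \<Rightarrow> (nat \<Rightarrow> 'a::comm_ring_1) \<Rightarrow> (nat \<Rightarrow> 'a) \<Rightarrow> 'a \<Rightarrow> 'a \<Rightarrow> nat \<Rightarrow> nat \<Rightarrow> 'a" where
  "lax_entry g I V y z i j =
    (if i = j then (if i = g + 1 then I 1 else I (i + 1)) + V i
     else if j = i + 1 then 1
     else if i = j + 1 then I i * V i
     else if i = 1 \<and> j = g + 1 then (- 1) ^ g * I 1 * V 1 * z
     else if i = g + 1 \<and> j = 1 then (- 1) ^ g * y
     else 0)"

text \<open>Matrix indices start at \<open>0\<close> in the library, hence the shift.\<close>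

definition lax ::
  "nat \<Rightarrow> (nat \<Rightarrow> 'a::comm_ring_1) \<Rightarrow> (nat \<Rightarrow> 'a) \<Rightarrow> 'a \<Rightarrow> 'a \<Rightarrow> 'a mat" where
  "lax g I V y z = mat (g + 1) (g + 1) (\<lambda>(i, j). lax_entry g I V y z (i + 1) (j + 1))"

text \<open>
  \<open>y det (x Id + L)\<close> as a Laurent series in \<open>y\<close> whose coefficients are polynomials in \<open>x\<close>.
\<close>

definition ftilde :: "nat \<Rightarrow> (nat \<Rightarrow> complex) \<Rightarrow> (nat \<Rightarrow> complex) \<Rightarrow> complex poly fls" where
  "ftilde g I V =
     fls_X * det (fls_const [:0, 1:] \<cdot>\<^sub>m 1\<^sub>m (g + 1) +
       lax g (\<lambda>i. fls_const [:I i:]) (\<lambda>i. fls_const [:V i:]) fls_X fls_X_inv)"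

text \<open>\<open>toda_c g I V i\<close> is \<open>c\<^sub>i\<close> for \<open>0 \<le> i \<le> g\<close>, and \<open>toda_cm1 g I V\<close> is \<open>c\<^sub>-\<^sub>1\<close>.\<close>

definition toda_c :: "nat \<Rightarrow> (nat \<Rightarrow> complex) \<Rightarrow> (nat \<Rightarrow> complex) \<Rightarrow> nat \<Rightarrow> complex" where
  "toda_c g I V i = Polynomial.coeff (fls_nth (ftilde g I V) 1) i"

definition toda_cm1 :: "nat \<Rightarrow> (nat \<Rightarrow> complex) \<Rightarrow> (nat \<Rightarrow> complex) \<Rightarrow> complex" where
  "toda_cm1 g I V = Polynomial.coeff (fls_nth (ftilde g I V) 0) 0"

definition s1_c :: "nat \<Rightarrow> (nat \<Rightarrow> complex) \<Rightarrow> (nat \<Rightarrow> complex) \<Rightarrow> nat \<Rightarrow> complex" where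
  "s1_c g I V i = toda_c g (I(1 := - I 1)) V i"

definition t_last_c :: "nat \<Rightarrow> (nat \<Rightarrow> complex) \<Rightarrow> (nat \<Rightarrow> complex) \<Rightarrow> nat \<Rightarrow> complex" where
  "t_last_c g I V i = toda_c g I (V(g + 1 := - V (g + 1))) i"

text \<open>
  Throughout, \<open>F\<close> has degree \<open>2g + 2\<close> and leading coefficient \<open>1\<close>, and the curve is the
  smooth completion of \<open>v\<^sup>2 = F(u)\<close>.
\<close>

definition nonsingular_curve :: "complex poly \<Rightarrow> bool" where
  "nonsingular_curve F \<longleftrightarrow>
     (\<forall>p q. q\<^sup>2 = poly F p \<longrightarrow> \<not> (2 * q = 0 \<and> poly (pderiv F) p = 0))"

text \<open>
  \<open>Inf_plus\<close> and \<open>Inf_minus\<close> are the points at infinity where \<open>v/u\<^sup>g\<^sup>+\<^sup>1\<close> takes the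
  values \<open>1\<close> and \<open>-1\<close>.
\<close>

datatype curve_point = Affine complex complex | Inf_plus | Inf_minus

definition curve_points :: "complex poly \<Rightarrow> curve_point set" where
  "curve_points F = {Affine p q | p q. q\<^sup>2 = poly F p} \<union> {Inf_plus, Inf_minus}"

text \<open>
  The function field is \<open>\<complex>(u) \<oplus> \<complex>(u) v\<close>; the pair \<open>(a, b)\<close> stands for \<open>a(u) + b(u) v\<close>.
\<close>

type_synonym rat_fun = "complex poly fract \<times> complex poly fract"

definition scale_fun :: "complex \<Rightarrow> rat_fun \<Rightarrow> rat_fun" where
  "scale_fun k h = (to_fract [:k:] * fst h, to_fract [:k:] * snd h)"

text \<open>
  A local parametrization of \<open>w\<^sup>2 = G(s)\<close> at the smooth point \<open>(p, q)\<close>: a pair of power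
  series with values on the curve, starting at the point, with nonzero tangent vector.
\<close>

definition local_param ::
  "complex poly \<Rightarrow> complex \<Rightarrow> complex \<Rightarrow> complex fps \<Rightarrow> complex fps \<Rightarrow> bool" where
  "local_param G p q S W \<longleftrightarrow>
     W\<^sup>2 = poly (map_poly fps_const G) S \<and>
     fps_nth S 0 = p \<and> fps_nth W 0 = q \<and> (fps_nth S 1 \<noteq> 0 \<or> fps_nth W 1 \<noteq> 0)"

text \<open>
  Laurent expansions of the coordinate functions \<open>u\<close>, \<open>v\<close> in a local parameter. Near
  infinity the smooth completion is the curve \<open>w\<^sup>2 = s\<^sup>2\<^sup>g\<^sup>+\<^sup>2 F(1/s)\<close>, with
  \<open>s = 1/u\<close> and \<open>w = v/u\<^sup>g\<^sup>+\<^sup>1\<close>.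
\<close>

definition expansion_at_infinity ::
  "nat \<Rightarrow> complex poly \<Rightarrow> complex \<Rightarrow> complex fls \<Rightarrow> complex fls \<Rightarrow> bool" where
  "expansion_at_infinity g F e u v \<longleftrightarrow>
     (\<exists>S W. local_param (reflect_poly F) 0 e S W \<and>
        u = inverse (fps_to_fls S) \<and> v = fps_to_fls W / fps_to_fls S ^ (g + 1))"

fun local_expansion ::
  "nat \<Rightarrow> complex poly \<Rightarrow> curve_point \<Rightarrow> complex fls \<Rightarrow> complex fls \<Rightarrow> bool" where
  "local_expansion g F (Affine p q) u v \<longleftrightarrow>
     (\<exists>S W. local_param F p q S W \<and> u = fps_to_fls S \<and> v = fps_to_fls W)"
| "local_expansion g F Inf_plus u v \<longleftrightarrow> expansion_at_infinity g F 1 u v"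
| "local_expansion g F Inf_minus u v \<longleftrightarrow> expansion_at_infinity g F (- 1) u v"

definition eval_fract :: "complex poly fract \<Rightarrow> complex fls \<Rightarrow> complex fls" where
  "eval_fract a u = (case quot_of_fract a of (n, d) \<Rightarrow>
     poly (map_poly fls_const n) u / poly (map_poly fls_const d) u)"

text \<open>
  Order of vanishing of a nonzero function. On a nonsingular curve a local expansion exists at
  every point, and two of them differ by an invertible substitution of the parameter, so the
  order does not depend on the choice.
\<close>

definition ord_at :: "nat \<Rightarrow> complex poly \<Rightarrow> curve_point \<Rightarrow> rat_fun \<Rightarrow> int" where
  "ord_at g F P h =
     (case (SOME (u, v). local_expansion g F P u v) of (u, v) \<Rightarrow>
        fls_subdegree (eval_fract (fst h) u + eval_fract (snd h) u * v))"

definition L_space ::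
  "nat \<Rightarrow> complex poly \<Rightarrow> (curve_point \<Rightarrow>\<^sub>0 int) \<Rightarrow> rat_fun set" where
  "L_space g F D =
     {h. h \<noteq> (0, 0) \<and> (\<forall>P\<in>curve_points F. ord_at g F P h + Poly_Mapping.lookup D P \<ge> 0)} \<union> {(0, 0)}"

definition D_star :: "nat \<Rightarrow> curve_point \<Rightarrow>\<^sub>0 int" where
  "D_star g =
     (if even g then frag_cmul (int (g div 2)) (frag_of Inf_plus + frag_of Inf_minus)
      else frag_cmul (int ((g - 1) div 2)) (frag_of Inf_plus + frag_of Inf_minus) + frag_of Inf_plus)"

definition passes_through :: "nat \<Rightarrow> complex poly \<Rightarrow> rat_fun \<Rightarrow> complex \<times> complex \<Rightarrow> bool" where
  "passes_through g F h P \<longleftrightarrow>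
     h \<noteq> (0, 0) \<and> Affine (fst P) (snd P) \<in> curve_points F \<and> ord_at g F (Affine (fst P) (snd P)) h > 0"

definition spectral_poly :: "nat \<Rightarrow> (nat \<Rightarrow> complex) \<Rightarrow> (nat \<Rightarrow> complex) \<Rightarrow> complex poly" where
  "spectral_poly g I V =
     (Polynomial.monom 1 (g + 1) + (\<Sum>i\<le>g. Polynomial.monom (toda_c g I V i) i))\<^sup>2
       - [:4 * toda_cm1 g I V:]"

definition rho ::
  "nat \<Rightarrow> (nat \<Rightarrow> complex) \<Rightarrow> (nat \<Rightarrow> complex) \<Rightarrow> complex \<times> complex \<Rightarrow> complex \<times> complex" where
  "rho g I V = (\<lambda>(x, y). (x, y - toda_cm1 g I V / y))"

definition upper_left :: "nat \<Rightarrow> 'a mat \<Rightarrow> 'a mat" where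
  "upper_left g M = mat g g (\<lambda>(i, j). M $$ (i, j))"

definition phi ::
  "nat \<Rightarrow> (nat \<Rightarrow> complex) \<Rightarrow> (nat \<Rightarrow> complex) \<Rightarrow> nat \<Rightarrow> complex \<Rightarrow> complex \<Rightarrow> complex" where
  "phi g I V i x y =
     det (replace_col (upper_left g (x \<cdot>\<^sub>m 1\<^sub>m (g + 1) + lax g I V y (1 / y)))
            (vec g (\<lambda>r. lax_entry g I V y (1 / y) (r + 1) (g + 1))) (i - 1))"

text \<open>
  The determinant of the upper left \<open>g \<times> g\<close> block of \<open>x Id + L\<close> as a polynomial in \<open>x\<close>;
  this block of \<open>L\<close> does not involve \<open>y\<close>, so that the value \<open>y = 1\<close> is immaterial.
\<close>

definition block_poly :: "nat \<Rightarrow> (nat \<Rightarrow> complex) \<Rightarrow> (nat \<Rightarrow> complex) \<Rightarrow> complex poly" where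
  "block_poly g I V = char_poly (- upper_left g (lax g I V 1 1))"

text \<open>
  The number of indices \<open>i\<close> with \<open>Q i = (x, y)\<close> is the multiplicity of \<open>(x, y)\<close> as a
  solution of \<open>\<phi>\<^sub>1 = \<phi>\<^sub>2 = 0\<close>. It equals the multiplicity of the root \<open>x\<close> of
  \<open>block_poly\<close>: modulo \<open>\<phi>\<^sub>1\<close> and \<open>\<phi>\<^sub>2\<close> the coordinate \<open>y\<close> is a polynomial in \<open>x\<close>, and
  what remains is the relation \<open>block_poly = 0\<close>.
\<close>

definition eigenvector_points ::
  "nat \<Rightarrow> (nat \<Rightarrow> complex) \<Rightarrow> (nat \<Rightarrow> complex) \<Rightarrow> (nat \<Rightarrow> complex \<times> complex) \<Rightarrow> bool" where
  "eigenvector_points g I V Q \<longleftrightarrow>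
     (\<forall>x y. card {i \<in> {1..g}. Q i = (x, y)} =
        (if y \<noteq> 0 \<and> phi g I V 1 x y = 0 \<and> phi g I V 2 x y = 0
         then Polynomial.order x (block_poly g I V) else 0))"

definition eigenvector_map ::
  "nat \<Rightarrow> (nat \<Rightarrow> complex) \<Rightarrow> (nat \<Rightarrow> complex) \<Rightarrow> (nat \<Rightarrow> complex \<times> complex) \<Rightarrow> bool" where
  "eigenvector_map g I V P \<longleftrightarrow>
     (\<exists>Q. eigenvector_points g I V Q \<and> (\<forall>i\<in>{1..g}. P i = rho g I V (Q i)))"

definition h1 :: "nat \<Rightarrow> (nat \<Rightarrow> complex) \<Rightarrow> (nat \<Rightarrow> complex) \<Rightarrow> rat_fun" where
  "h1 g I V =
     (if even g
      then (to_fract ((\<Sum>i\<le>g. Polynomial.monom (s1_c g I V i) i) + Polynomial.monom 1 (g + 1)), - 1)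
      else (to_fract ((\<Sum>i\<le>g. Polynomial.monom (t_last_c g I V i) i) + Polynomial.monom 1 (g + 1)), 1))"

end

theory Submission
  imports Defs
begin

text \<open>
  Let \<open>K\<close> denote the tridiagonal block determinants of \<open>x Id + L\<close>. Expanding \<open>det (x Id + L)\<close> gives
  \<open>y + c(x) + c\<^sub>-\<^sub>1 / y\<close>, where \<open>c = (x + I\<^sub>1 + V\<^sub>g\<^sub>+\<^sub>1) K\<^sub>1\<^sub>g - I\<^sub>g\<^sub>+\<^sub>1 V\<^sub>g\<^sub>+\<^sub>1 K\<^sub>1\<^sub>,\<^sub>g\<^sub>-\<^sub>1 - I\<^sub>1 V\<^sub>1 K\<^sub>2\<^sub>g\<close> and no
  block \<open>K\<close> involves \<open>I\<^sub>1\<close> or \<open>V\<^sub>g\<^sub>+\<^sub>1\<close>. At the points of the eigenvector map \<open>K\<^sub>1\<^sub>g\<close> vanishes and the two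
  remaining terms of \<open>c\<close> are \<open>- c\<^sub>-\<^sub>1 / y\<close> and \<open>- y\<close>; changing the sign of \<open>I\<^sub>1\<close> or of \<open>V\<^sub>g\<^sub>+\<^sub>1\<close> flips
  exactly one of them and yields \<open>\<plusminus> v\<close> instead of \<open>c\<close>. Hence \<open>h\<^sub>1\<close> vanishes at all \<open>P\<^sub>i\<close>, and the
  factorization of \<open>c(0)\<close> handles \<open>A\<close>.

  Conversely, a function with poles only at infinity is \<open>a(u) + b(u) v\<close> with polynomials \<open>a\<close>, \<open>b\<close>; the
  bounds on the poles force \<open>deg a \<le> g + 1\<close>, \<open>b\<close> constant, and tie \<open>b\<close> to the top coefficient of \<open>a\<close>.
  After subtracting a multiple of \<open>h\<^sub>1\<close> there remains a polynomial in \<open>u\<close> of degree at most \<open>g\<close> with the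
  \<open>g + 1\<close> distinct roots \<open>0, p\<^sub>1, \<dots>, p\<^sub>g\<close>, which is zero.
\<close>

section \<open>Determinants of periodic tridiagonal matrices\<close>


text \<open>Determinant of the tridiagonal block on the indices \<open>a, ..., a + n - 1\<close>:
  ones above the diagonal, and \<open>s i\<close> left of the diagonal in row \<open>i\<close>. The
  ring is arbitrary so that complex numbers, polynomials and Laurent series are treated
  alike.\<close>

fun continuant :: "(nat \<Rightarrow> 'a::comm_ring_1) \<Rightarrow> (nat \<Rightarrow> 'a) \<Rightarrow> nat \<Rightarrow> nat \<Rightarrow> 'a" where
  "continuant d s a 0 = 1"
| "continuant d s a (Suc 0) = d a"
| "continuant d s a (Suc (Suc n)) =
     d (a + Suc n) * continuant d s a (Suc n) - s (a + Suc n) * continuant d s a n"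

definition tridiag :: "(nat \<Rightarrow> 'a::comm_ring_1) \<Rightarrow> (nat \<Rightarrow> 'a) \<Rightarrow> nat \<Rightarrow> nat \<Rightarrow> 'a mat" where
  "tridiag d s a n = mat n n (\<lambda>(i, j).
     if i = j then d (a + i) else if j = Suc i then 1 else if i = Suc j then s (a + i) else 0)"

definition cyclic_tridiag ::
  "(nat \<Rightarrow> 'a::comm_ring_1) \<Rightarrow> (nat \<Rightarrow> 'a) \<Rightarrow> 'a \<Rightarrow> 'a \<Rightarrow> nat \<Rightarrow> 'a mat" where
  "cyclic_tridiag d s \<alpha> \<beta> g = mat (g + 1) (g + 1) (\<lambda>(i, j).
     if i = j then d (Suc i) else if j = Suc i then 1 else if i = Suc j then s (Suc i)
     else if i = 0 \<and> j = g then \<alpha> else if i = g \<and> j = 0 then \<beta> else 0)"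

lemma sum_lessThan_restrict:
  fixes f :: "nat \<Rightarrow> 'a::comm_monoid_add"
  assumes "S \<subseteq> {..<n}" and "\<And>j. j < n \<Longrightarrow> j \<notin> S \<Longrightarrow> f j = 0"
  shows "sum f {..<n} = sum f S"
  by (rule sum.mono_neutral_right) (use assms in auto)

lemma det_unit_column_last:
  fixes N :: "'a::comm_ring_1 mat"
  assumes N: "N \<in> carrier_mat (Suc n) (Suc n)"
    and z: "\<And>i. i < n \<Longrightarrow> N $$ (i, n) = 0"
  shows "det N = N $$ (n, n) * det (mat_delete N n n)"
proof -
  have "det N = (\<Sum>i<Suc n. N $$ (i, n) * cofactor N i n)"
    by (rule laplace_expansion_column[OF N]) simp
  also have "\<dots> = (\<Sum>i\<in>{n}. N $$ (i, n) * cofactor N i n)"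
    by (rule sum_lessThan_restrict) (use z in auto)
  finally show ?thesis by (simp add: cofactor_def flip: mult_2)
qed

text \<open>Expansion along the last row leaves two minors. The one of the subdiagonal entry has a
  last column that is zero except for the unit in its corner, so it shrinks once more.\<close>

lemma det_tridiag: "det (tridiag d s a n) = continuant d s a n"
proof (induction d s a n rule: continuant.induct)
  case (1 d s a)
  show ?case by (simp add: tridiag_def)
next
  case (2 d s a)
  show ?case
    by (simp add: tridiag_def det_single)
next
  case (3 d s a n)
  let ?M = "tridiag d s a (Suc (Suc n))"
  let ?N = "mat_delete ?M (Suc n) n"
  have M: "?M \<in> carrier_mat (Suc (Suc n)) (Suc (Suc n))" by (simp add: tridiag_def)
  have N: "?N \<in> carrier_mat (Suc n) (Suc n)" by (simp add: tridiag_def mat_delete_def)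
  have "det ?M = (\<Sum>j<Suc (Suc n). ?M $$ (Suc n, j) * cofactor ?M (Suc n) j)"
    by (rule laplace_expansion_row[OF M]) simp
  also have "\<dots> = (\<Sum>j\<in>{n, Suc n}. ?M $$ (Suc n, j) * cofactor ?M (Suc n) j)"
    by (rule sum_lessThan_restrict) (auto simp: tridiag_def)
  also have "\<dots> = d (a + Suc n) * det (mat_delete ?M (Suc n) (Suc n)) - s (a + Suc n) * det ?N"
    by (simp add: cofactor_def) (simp add: tridiag_def flip: mult_2)
  also have "mat_delete ?M (Suc n) (Suc n) = tridiag d s a (Suc n)"
    by (rule eq_matI) (auto simp: tridiag_def mat_delete_def)
  also have "det ?N = ?N $$ (n, n) * det (mat_delete ?N n n)"
    by (rule det_unit_column_last[OF N]) (auto simp: tridiag_def mat_delete_def)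
  also have "?N $$ (n, n) = 1" by (simp add: tridiag_def mat_delete_def)
  also have "mat_delete ?N n n = tridiag d s a n"
    by (rule eq_matI) (auto simp: tridiag_def mat_delete_def)
  finally show ?case using 3 by simp
qed

lemma prod_list_map_upt: "prod_list (map f [0..<n]) = (\<Prod>i<n. f i :: 'a::comm_monoid_mult)"
  by (induction n) (simp_all add: mult.commute)

text \<open>The last row has three nonzero entries. Besides block determinants, the two full cycles
  of the indices give the terms linear in \<alpha> and in \<beta>, and exchanging the first and last
  index gives the term with their product.\<close>

lemma det_cyclic_tridiag:
  fixes d s :: "nat \<Rightarrow> 'a::comm_ring_1"
  assumes "g \<ge> 2"
  shows "det (cyclic_tridiag d s \<alpha> \<beta> g) =
     d (Suc g) * continuant d s 1 g - s (Suc g) * continuant d s 1 (g - 1)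
     - \<alpha> * \<beta> * continuant d s 2 (g - 1) + (- 1) ^ g * \<beta> + (- 1) ^ g * \<alpha> * (\<Prod>i<g. s (i + 2))"
proof -
  obtain k where g: "g = Suc (Suc k)" using assms by (metis add_2_eq_Suc le_Suc_ex)
  let ?M = "cyclic_tridiag d s \<alpha> \<beta> g"
  have M: "?M \<in> carrier_mat (Suc g) (Suc g)" by (simp add: cyclic_tridiag_def)
  let ?N = "mat_delete ?M g (Suc k)" and ?R = "mat_delete ?M g 0"
  have N: "?N \<in> carrier_mat g g" and R: "?R \<in> carrier_mat g g"
    by (simp_all add: cyclic_tridiag_def mat_delete_def)
  have "det ?M = (\<Sum>j<Suc g. ?M $$ (g, j) * cofactor ?M g j)"
    by (rule laplace_expansion_row[OF M]) simp
  also have "\<dots> = (\<Sum>j\<in>{0, Suc k, g}. ?M $$ (g, j) * cofactor ?M g j)"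
    by (rule sum_lessThan_restrict) (auto simp: cyclic_tridiag_def g)
  also have "\<dots> = d (Suc g) * det (mat_delete ?M g g) - s (Suc g) * det ?N + (- 1) ^ g * \<beta> * det ?R"
    by (simp add: g cofactor_def) (simp add: cyclic_tridiag_def flip: mult_2)
  also have "mat_delete ?M g g = tridiag d s 1 g"
    by (rule eq_matI) (auto simp: tridiag_def cyclic_tridiag_def mat_delete_def)
  also have "det ?N = continuant d s 1 (g - 1) + (- 1) ^ Suc k * \<alpha> * (\<Prod>i<Suc k. s (i + 2))"
  proof -
    let ?T = "mat_delete ?N 0 (Suc k)"
    have T: "?T \<in> carrier_mat (Suc k) (Suc k)" by (simp add: g cyclic_tridiag_def mat_delete_def)
    have "det ?N = (\<Sum>i<g. ?N $$ (i, Suc k) * cofactor ?N i (Suc k))"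
      by (rule laplace_expansion_column[OF N]) (simp add: g)
    also have "\<dots> = (\<Sum>i\<in>{0, Suc k}. ?N $$ (i, Suc k) * cofactor ?N i (Suc k))"
      by (rule sum_lessThan_restrict) (auto simp: cyclic_tridiag_def mat_delete_def g)
    also have "\<dots> = det (mat_delete ?N (Suc k) (Suc k)) + (- 1) ^ Suc k * \<alpha> * det ?T"
      by (simp add: g cofactor_def) (simp add: cyclic_tridiag_def mat_delete_def flip: mult_2)
    also have "mat_delete ?N (Suc k) (Suc k) = tridiag d s 1 (g - 1)"
      by (rule eq_matI) (auto simp: g tridiag_def cyclic_tridiag_def mat_delete_def)
    \<comment> \<open>Deleting row 0 has moved the subdiagonal of \<open>?M\<close> onto the
      diagonal.\<close>
    also have "det ?T = prod_list (diag_mat ?T)"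
      by (rule det_upper_triangular[OF _ T])
         (auto simp: upper_triangular_def g cyclic_tridiag_def mat_delete_def)
    also have "diag_mat ?T = map (\<lambda>i. s (i + 2)) [0..<Suc k]"
      using T by (auto simp: diag_mat_def g cyclic_tridiag_def mat_delete_def)
    finally show ?thesis by (simp only: det_tridiag prod_list_map_upt)
  qed
  also have "det ?R = 1 + (- 1) ^ Suc k * \<alpha> * continuant d s 2 (g - 1)"
  proof -
    let ?T = "mat_delete ?R (Suc k) (Suc k)"
    have T: "?T \<in> carrier_mat (Suc k) (Suc k)" by (simp add: g cyclic_tridiag_def mat_delete_def)
    have "det ?R = (\<Sum>i<g. ?R $$ (i, Suc k) * cofactor ?R i (Suc k))"
      by (rule laplace_expansion_column[OF R]) (simp add: g)
    also have "\<dots> = (\<Sum>i\<in>{0, Suc k}. ?R $$ (i, Suc k) * cofactor ?R i (Suc k))"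
      by (rule sum_lessThan_restrict) (auto simp: cyclic_tridiag_def mat_delete_def g)
    also have "\<dots> = det ?T + (- 1) ^ Suc k * \<alpha> * det (mat_delete ?R 0 (Suc k))"
      by (simp add: g cofactor_def) (simp add: cyclic_tridiag_def mat_delete_def flip: mult_2)
    also have "mat_delete ?R 0 (Suc k) = tridiag d s 2 (g - 1)"
      by (rule eq_matI) (auto simp: g tridiag_def cyclic_tridiag_def mat_delete_def)
    \<comment> \<open>Deleting column 0 has moved the superdiagonal of ones onto the
      diagonal.\<close>
    also have "det ?T = prod_list (diag_mat ?T)"
      by (rule det_lower_triangular[OF _ T])
         (auto simp: g cyclic_tridiag_def mat_delete_def)
    also have "diag_mat ?T = map (\<lambda>i. 1) [0..<Suc k]"
      using T by (auto simp: diag_mat_def g cyclic_tridiag_def mat_delete_def)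
    finally show ?thesis by (simp only: det_tridiag prod_list_map_upt) simp
  qed
  finally show ?thesis
    by (simp add: det_tridiag g algebra_simps flip: power_add mult_2)
qed

text \<open>The entry \<open>s a\<close> lies to the left of the block, hence the strict inequality
  in the second premise. This is why blocks starting at index 1 do not see a sign change of
  \<open>I 1\<close>.\<close>

lemma continuant_cong:
  assumes "\<And>i. a \<le> i \<Longrightarrow> i < a + n \<Longrightarrow> d i = d' i"
    and "\<And>i. a < i \<Longrightarrow> i < a + n \<Longrightarrow> s i = s' i"
  shows "continuant d s a n = continuant d' s' a n"
  using assms by (induction d s a n rule: continuant.induct) auto

lemma continuant_hom:
  assumes "f 1 = 1" "\<And>x y. f (x * y) = f x * f y" "\<And>x y. f (x - y) = f x - f y"
  shows "f (continuant d s a n) = continuant (\<lambda>i. f (d i)) (\<lambda>i. f (s i)) a n"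
  by (induction d s a n rule: continuant.induct) (simp_all add: assms)

text \<open>The Desnanot-Jacobi identity for a tridiagonal block. By the recursion in the last
  index, the left side is multiplied by the next subdiagonal entry at each step.\<close>

lemma continuant_det_identity:
  "continuant d s a (Suc n) * continuant d s (Suc a) (Suc n)
     - continuant d s a (Suc (Suc n)) * continuant d s (Suc a) n = (\<Prod>i<Suc n. s (Suc a + i))"
proof (induction n)
  case (Suc n)
  have "continuant d s a (Suc (Suc n)) * continuant d s (Suc a) (Suc (Suc n))
     - continuant d s a (Suc (Suc (Suc n))) * continuant d s (Suc a) (Suc n) =
     s (Suc a + Suc n) * (continuant d s a (Suc n) * continuant d s (Suc a) (Suc n)
     - continuant d s a (Suc (Suc n)) * continuant d s (Suc a) n)"
    by (simp add: algebra_simps)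
  then show ?case unfolding Suc by (simp add: mult.commute)
qed simp

lemma coeff_continuant_linear:
  fixes e :: "nat \<Rightarrow> 'a::comm_ring_1"
  \<comment> \<open>Block determinants are monic in the variable. Bound and coefficient are proved
    together, since the top coefficient of the recursion relies on the vanishing of coefficients
    beyond the bound.\<close>
  shows "degree (continuant (\<lambda>i. [:e i, 1:]) (\<lambda>i. [:s i:]) a n) \<le> n \<and>
     coeff (continuant (\<lambda>i. [:e i, 1:]) (\<lambda>i. [:s i:]) a n) n = 1"
proof (induction "\<lambda>i. [:e i, 1:]" "\<lambda>i. [:s i:]" a n rule: continuant.induct)
  case (3 a n)
  let ?K = "continuant (\<lambda>i. [:e i, 1:]) (\<lambda>i. [:s i:]) a"
  have "degree ([:e (a + Suc n), 1:] * ?K (Suc n)) \<le> 1 + Suc n"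
    by (rule order_trans[OF degree_mult_le]) (use 3 in \<open>auto intro!: add_mono\<close>)
  moreover have "degree ([:s (a + Suc n):] * ?K n) \<le> Suc n"
    by (rule order_trans[OF degree_mult_le]) (use 3 in auto)
  moreover have "coeff (?K (Suc n)) (Suc (Suc n)) = 0" "coeff (?K n) (Suc (Suc n)) = 0"
    using 3 by (auto intro: coeff_eq_0)
  ultimately show ?case using 3 by (auto intro!: degree_diff_le)
qed auto

section \<open>The spectral polynomial\<close>

text \<open>\<open>toda_block I V x a n\<close> is the determinant of the block of \<open>x Id + L\<close> in the rows and
  columns \<open>a, \<dots>, a + n - 1\<close>, provided that it does not contain the last row.\<close>

definition toda_block ::
  "(nat \<Rightarrow> 'a::comm_ring_1) \<Rightarrow> (nat \<Rightarrow> 'a) \<Rightarrow> 'a \<Rightarrow> nat \<Rightarrow> nat \<Rightarrow> 'a" where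
  "toda_block I V x a n = continuant (\<lambda>i. x + I (Suc i) + V i) (\<lambda>i. I i * V i) a n"

text \<open>The cyclic version of the continuant, that is, the trace of the product of the transfer
  matrices of the three-term recursion.\<close>

definition toda_trace ::
  "nat \<Rightarrow> (nat \<Rightarrow> 'a::comm_ring_1) \<Rightarrow> (nat \<Rightarrow> 'a) \<Rightarrow> 'a \<Rightarrow> 'a" where
  "toda_trace g I V x =
     (x + I 1 + V (g + 1)) * toda_block I V x 1 g
     - I (g + 1) * V (g + 1) * toda_block I V x 1 (g - 1) - I 1 * V 1 * toda_block I V x 2 (g - 1)"

lemma toda_block_hom:
  assumes "f 1 = 1" "\<And>x y. f (x * y) = f x * f y" "\<And>x y. f (x - y) = f x - f y"
    "\<And>x y. f (x + y) = f x + f y"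
  shows "f (toda_block I V x a n) = toda_block (\<lambda>i. f (I i)) (\<lambda>i. f (V i)) (f x) a n"
  unfolding toda_block_def by (subst continuant_hom[of f]) (simp_all add: assms)

lemma toda_trace_hom:
  assumes "f 1 = 1" "\<And>x y. f (x * y) = f x * f y" "\<And>x y. f (x - y) = f x - f y"
    "\<And>x y. f (x + y) = f x + f y"
  shows "f (toda_trace g I V x) = toda_trace g (\<lambda>i. f (I i)) (\<lambda>i. f (V i)) (f x)"
  unfolding toda_trace_def by (simp add: toda_block_hom[of f, OF assms] assms)

text \<open>The signs of the corner entries cancel those of the two cyclic permutations, and the
  product of the corners collapses to \<open>I 1 * V 1\<close>. Assuming only
  \<open>y * z = 1\<close> covers Laurent series in \<open>y\<close>.\<close>

lemma det_lax:
  fixes x y z :: "'a::comm_ring_1"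
  assumes g: "g \<ge> 2" and yz: "y * z = 1"
  shows "det (x \<cdot>\<^sub>m 1\<^sub>m (g + 1) + lax g I V y z) =
     toda_trace g I V x + y + z * (\<Prod>i=1..g+1. I i * V i)"
proof -
  let ?d = "\<lambda>i. x + (if i = g + 1 then I 1 else I (i + 1)) + V i" and ?s = "\<lambda>i. I i * V i"
  let ?al = "(- 1) ^ g * I 1 * V 1 * z" and ?be = "(- 1) ^ g * y"
  have M: "x \<cdot>\<^sub>m 1\<^sub>m (g + 1) + lax g I V y z = cyclic_tridiag ?d ?s ?al ?be g"
    by (rule eq_matI) (use g in \<open>auto simp: lax_def lax_entry_def cyclic_tridiag_def\<close>)
  \<comment> \<open>A block that stops before row \<open>g + 1\<close> avoids the exceptional
    diagonal entry with \<open>I 1\<close>.\<close>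
  have K: "continuant ?d ?s a n = toda_block I V x a n" if "a + n \<le> g + 1" for a n
    unfolding toda_block_def by (rule continuant_cong) (use that in auto)
  have P: "(\<Prod>i=1..g+1. I i * V i) = I 1 * V 1 * (\<Prod>i<g. ?s (i + 2))"
  proof -
    have "(\<Prod>i=1..g+1. I i * V i) = (\<Prod>i<Suc g. ?s (Suc i))"
      by (rule prod.reindex_bij_witness[of _ Suc "\<lambda>i. i - 1"]) auto
    then show ?thesis by (simp only: prod.lessThan_Suc_shift) simp
  qed
  have e: "(- 1) ^ g * ((- 1) ^ g * w) = w" for w :: 'a
    by (simp flip: mult.assoc power_add mult_2)
  have "?al * ?be = (- 1) ^ g * ((- 1) ^ g * (I 1 * V 1 * (y * z)))" by (simp only: ac_simps)
  then have ab: "?al * ?be = I 1 * V 1" by (simp only: e yz) simp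
  have c: "(- 1) ^ g * ?al * (\<Prod>i<g. ?s (i + 2)) = z * (\<Prod>i=1..g+1. I i * V i)"
    unfolding P using e[of "I 1 * V 1 * z * (\<Prod>i<g. ?s (i + 2))"] by (simp only: ac_simps)
  have b: "(- 1) ^ g * ?be = y" by (rule e)
  have K': "continuant ?d ?s 1 g = toda_block I V x 1 g"
    "continuant ?d ?s 1 (g - 1) = toda_block I V x 1 (g - 1)"
    "continuant ?d ?s 2 (g - 1) = toda_block I V x 2 (g - 1)"
    by (rule K; use g in simp)+
  show ?thesis
    unfolding M det_cyclic_tridiag[OF g] ab b c K' toda_trace_def by simp
qed

text \<open>The same expression over polynomials, with the indeterminate for \<open>x\<close>.
  Evaluation at a point and inclusion into Laurent series are then ring homomorphisms applied to
  \<open>toda_trace\<close>.\<close>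

definition toda_poly :: "nat \<Rightarrow> (nat \<Rightarrow> complex) \<Rightarrow> (nat \<Rightarrow> complex) \<Rightarrow> complex poly" where
  "toda_poly g I V = toda_trace g (\<lambda>i. [:I i:]) (\<lambda>i. [:V i:]) [:0, 1:]"

lemma poly_toda_poly: "poly (toda_poly g I V) x = toda_trace g I V x"
  unfolding toda_poly_def by (subst toda_trace_hom[where f = "\<lambda>p. poly p x"]) simp_all

lemma prod_pCons_0: "(\<Prod>i\<in>A. [:f i:]) = [:\<Prod>i\<in>A. f i:]"
  by (induction A rule: infinite_finite_induct) (simp_all add: pCons_one mult.commute)

lemma prod_fls_const: "(\<Prod>i\<in>A. fls_const (f i)) = fls_const (\<Prod>i\<in>A. f i :: 'a::comm_ring_1)"
  by (induction A rule: infinite_finite_induct) simp_all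

text \<open>The outer factor \<open>y\<close> shifts the three terms of \<open>det_lax\<close> to
  the exponents 1, 2 and 0, which are those read off by \<open>toda_c\<close> and
  \<open>toda_cm1\<close>.\<close>

lemma ftilde_eq:
  assumes "g \<ge> 2"
  shows "ftilde g I V = fls_X * fls_const (toda_poly g I V) + fls_X\<^sup>2
     + fls_const [:\<Prod>i=1..g+1. I i * V i:]"
proof -
  have XX: "fls_X * fls_X_inv = (1 :: complex poly fls)"
    by (simp add: fls_X_times_conv_shift(1) fls_X_inv_conv_shift_1)
  have "toda_trace g (\<lambda>i. fls_const [:I i:]) (\<lambda>i. fls_const [:V i:]) (fls_const [:0, 1:]) =
      fls_const (toda_poly g I V)"
    unfolding toda_poly_def by (subst toda_trace_hom[where f = fls_const])
      (simp_all add: fls_plus_const fls_minus_const)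
  moreover have "(\<Prod>i=1..g+1. fls_const [:I i:] * fls_const [:V i:]) =
      fls_const [:\<Prod>i=1..g+1. I i * V i:]"
    using prod_fls_const[of "\<lambda>i. [:I i * V i:]" "{1..g+1}"] by (simp add: prod_pCons_0 mult.commute)
  ultimately show ?thesis
    unfolding ftilde_def det_lax[OF assms XX]
    by (simp add: distrib_left power2_eq_square XX flip: mult.assoc)
qed

text \<open>Only the first of the three summands reaches degree \<open>g + 1\<close>, and it is a
  product of monic polynomials.\<close>

lemma degree_toda_poly:
  assumes "g \<ge> 2"
  shows "degree (toda_poly g I V) \<le> g + 1" and "coeff (toda_poly g I V) (g + 1) = 1"
proof -
  let ?K = "continuant (\<lambda>i. [:I (Suc i) + V i, 1:]) (\<lambda>i. [:I i * V i:])"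
  note K = coeff_continuant_linear[of "\<lambda>i. I (Suc i) + V i" "\<lambda>i. I i * V i"]
  have eq: "toda_poly g I V = [:I 1 + V (g + 1), 1:] * ?K 1 g
      - [:I (g + 1) * V (g + 1):] * ?K 1 (g - 1) - [:I 1 * V 1:] * ?K 2 (g - 1)"
    unfolding toda_poly_def toda_trace_def toda_block_def by (simp add: mult.commute)
  have "degree ([:I 1 + V (g + 1), 1:] * ?K 1 g) \<le> 1 + g"
    by (rule order_trans[OF degree_mult_le]) (use K[of 1 g] in \<open>auto intro!: add_mono\<close>)
  moreover have s: "degree ([:c:] * ?K a (g - 1)) \<le> g" for c a
    by (rule order_trans[OF degree_mult_le]) (use K[of a "g - 1"] in auto)
  ultimately show "degree (toda_poly g I V) \<le> g + 1"
    unfolding eq by (intro degree_diff_le) (auto intro: le_SucI simp del: mult_pCons_left)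
  have "coeff ([:c:] * ?K a (g - 1)) (g + 1) = 0" for c a
    using s[of c a] by (intro coeff_eq_0) auto
  moreover have "coeff ([:I 1 + V (g + 1), 1:] * ?K 1 g) (g + 1) = 1"
    using K[of 1 g] by (auto intro: coeff_eq_0)
  ultimately show "coeff (toda_poly g I V) (g + 1) = 1"
    unfolding eq by (simp only: coeff_diff) simp
qed

lemma toda_c_eq: "g \<ge> 2 \<Longrightarrow> toda_c g I V i = coeff (toda_poly g I V) i"
  unfolding toda_c_def by (simp add: ftilde_eq power2_eq_square)

lemma toda_cm1_eq: "g \<ge> 2 \<Longrightarrow> toda_cm1 g I V = (\<Prod>i=1..g+1. I i * V i)"
  unfolding toda_cm1_def by (simp add: ftilde_eq power2_eq_square)

lemma sum_monom_toda_c: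
  assumes "g \<ge> 2"
  shows "(\<Sum>i\<le>g. monom (toda_c g I V i) i) + monom 1 (g + 1) = toda_poly g I V"
proof -
  have "toda_poly g I V = (\<Sum>i\<le>g+1. monom (coeff (toda_poly g I V) i) i)"
    using degree_toda_poly(1)[OF assms] by (rule poly_as_sum_of_monoms'[symmetric])
  then show ?thesis using degree_toda_poly(2)[OF assms] by (simp add: toda_c_eq[OF assms])
qed

section \<open>The points of the eigenvector map\<close>

text \<open>A characteristic polynomial is \<open>det (x Id - A)\<close>; the negated block turns
  the sign into that of \<open>x Id + L\<close>.\<close>

lemma block_poly_eq:
  assumes "g \<ge> 2"
  shows "block_poly g I V = continuant (\<lambda>i. [:I (Suc i) + V i, 1:]) (\<lambda>i. [:I i * V i:]) 1 g"
proof -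
  have "char_poly_matrix (- upper_left g (lax g I V 1 1)) =
      tridiag (\<lambda>i. [:I (Suc i) + V i, 1:]) (\<lambda>i. [:I i * V i:]) 1 g"
    by (rule eq_matI)
       (use assms in \<open>auto simp: char_poly_matrix_def upper_left_def lax_def lax_entry_def tridiag_def pCons_one\<close>)
  then show ?thesis
    unfolding block_poly_def char_poly_def by (simp add: det_tridiag)
qed

lemma poly_block_poly: "g \<ge> 2 \<Longrightarrow> poly (block_poly g I V) x = toda_block I V x 1 g"
  unfolding block_poly_eq toda_block_def by (subst continuant_hom[where f = "\<lambda>p. poly p x"]) (simp_all add: algebra_simps)

text \<open>The substituted first column contains only the corner entry and, in row
  \<open>g\<close>, a unit of the superdiagonal. Their minors are the block on
  \<open>2, ..., g\<close> and a triangular matrix with unit diagonal. For nonzero \<open>y\<close>,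
  vanishing thus determines \<open>y\<close>.\<close>

lemma phi_1_eq:
  assumes "g \<ge> 2"
  shows "phi g I V 1 x y = (- 1) ^ g * (I 1 * V 1 / y * toda_block I V x 2 (g - 1) - 1)"
proof -
  obtain k where g: "g = Suc (Suc k)" using assms by (metis add_2_eq_Suc le_Suc_ex)
  let ?M = "replace_col (upper_left g (x \<cdot>\<^sub>m 1\<^sub>m (g + 1) + lax g I V y (1 / y)))
            (vec g (\<lambda>r. lax_entry g I V y (1 / y) (r + 1) (g + 1))) 0"
  let ?d = "\<lambda>i. x + I (Suc i) + V i" and ?s = "\<lambda>i. I i * V i"
  have M: "?M \<in> carrier_mat g g" by (simp add: replace_col_def upper_left_def)
  let ?T = "mat_delete ?M (Suc k) 0"
  have T: "?T \<in> carrier_mat (Suc k) (Suc k)"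
    by (simp add: g replace_col_def upper_left_def mat_delete_def)
  have "det ?M = (\<Sum>i<g. ?M $$ (i, 0) * cofactor ?M i 0)"
    by (rule laplace_expansion_column[OF M]) (simp add: g)
  also have "\<dots> = (\<Sum>i\<in>{0, Suc k}. ?M $$ (i, 0) * cofactor ?M i 0)"
    by (rule sum_lessThan_restrict) (auto simp: replace_col_def upper_left_def lax_entry_def g)
  also have "\<dots> = (- 1) ^ g * (I 1 * V 1 / y) * det (mat_delete ?M 0 0) + (- 1) ^ Suc k * det ?T"
    by (simp add: g cofactor_def) (simp add: replace_col_def upper_left_def lax_entry_def)
  also have "mat_delete ?M 0 0 = tridiag ?d ?s 2 (g - 1)"
    by (rule eq_matI)
       (auto simp: g replace_col_def upper_left_def lax_def lax_entry_def tridiag_def mat_delete_def)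
  also have "det ?T = prod_list (diag_mat ?T)"
    by (rule det_lower_triangular[OF _ T])
       (auto simp: g replace_col_def upper_left_def lax_def lax_entry_def mat_delete_def)
  also have "diag_mat ?T = map (\<lambda>i. 1) [0..<Suc k]"
    using T by (auto simp: diag_mat_def g replace_col_def upper_left_def lax_def lax_entry_def mat_delete_def)
  finally show ?thesis
    by (simp add: phi_def det_tridiag prod_list_map_upt toda_block_def) (simp add: g algebra_simps)
qed

lemma toda_block_flip_first:
  "a > 0 \<Longrightarrow> toda_block (I(1 := - I 1)) V x a n = toda_block I V x a n"
  unfolding toda_block_def by (rule continuant_cong) auto

lemma toda_block_flip_last:
  "a + n \<le> g + 1 \<Longrightarrow> toda_block I (V(g + 1 := - V (g + 1))) x a n = toda_block I V x a n"
  unfolding toda_block_def by (rule continuant_cong) auto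

lemma toda_trace_flip_first:
  fixes x :: "'a::comm_ring_1"
  assumes "g \<ge> 2"
  shows "toda_trace g (I(1 := - I 1)) V x = (x - I 1 + V (g + 1)) * toda_block I V x 1 g
     - I (g + 1) * V (g + 1) * toda_block I V x 1 (g - 1) + I 1 * V 1 * toda_block I V x 2 (g - 1)"
  using assms toda_block_flip_first[of 1 I V x] toda_block_flip_first[of 2 I V x]
  unfolding toda_trace_def by simp

lemma toda_trace_flip_last:
  fixes x :: "'a::comm_ring_1"
  assumes "g \<ge> 2"
  shows "toda_trace g I (V(g + 1 := - V (g + 1))) x = (x + I 1 - V (g + 1)) * toda_block I V x 1 g
     + I (g + 1) * V (g + 1) * toda_block I V x 1 (g - 1) - I 1 * V 1 * toda_block I V x 2 (g - 1)"
  using assms toda_block_flip_last[of 1 g g I V x] toda_block_flip_last[of 1 "g - 1" g I V x]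
    toda_block_flip_last[of 2 "g - 1" g I V x]
  unfolding toda_trace_def by simp

text \<open>The middle factor is the product supplied by the Desnanot-Jacobi identity for the block
  on \<open>1, ..., g\<close>.\<close>

lemma prod_toda_split:
  fixes I V :: "nat \<Rightarrow> 'a::comm_ring_1"
  assumes "g \<ge> 2"
  shows "(\<Prod>i=1..g+1. I i * V i) =
    I 1 * V 1 * (\<Prod>i<g-1. I (2 + i) * V (2 + i)) * (I (g + 1) * V (g + 1))"
proof -
  obtain k where g: "g = Suc (Suc k)" using assms by (metis add_2_eq_Suc le_Suc_ex)
  have "(\<Prod>i=1..g+1. I i * V i) = (\<Prod>i<Suc g. I (Suc i) * V (Suc i))"
    by (rule prod.reindex_bij_witness[of _ Suc "\<lambda>i. i - 1"]) auto
  also have "\<dots> = I 1 * V 1 * (\<Prod>i<g-1. I (2 + i) * V (2 + i)) * (I (g + 1) * V (g + 1))"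
    by (subst prod.lessThan_Suc_shift) (simp add: g mult_ac)
  finally show ?thesis .
qed

text \<open>At a point of the eigenvector map, where \<open>y = I\<^sub>1 V\<^sub>1 det (block 2, \<dots>, g)\<close>, the Desnanot-Jacobi
  identity turns \<open>c\<^sub>-\<^sub>1 / y\<close> into \<open>I\<^sub>g\<^sub>+\<^sub>1 V\<^sub>g\<^sub>+\<^sub>1 det (block 1, \<dots>, g - 1)\<close>.\<close>

lemma toda_trace_at_eigenvector_point:
  fixes x y :: complex
  assumes g: "g \<ge> 2" and y: "y \<noteq> 0" and phi: "phi g I V 1 x y = 0"
    and root: "toda_block I V x 1 g = 0"
  defines "q \<equiv> y - (\<Prod>i=1..g+1. I i * V i) / y"
  shows "toda_trace g (I(1 := - I 1)) V x = q"
    and "toda_trace g I (V(g + 1 := - V (g + 1))) x = - q"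
    and "q\<^sup>2 = (toda_trace g I V x)\<^sup>2 - 4 * (\<Prod>i=1..g+1. I i * V i)"
proof -
  let ?k1 = "toda_block I V x 1 (g - 1)" and ?k2 = "toda_block I V x 2 (g - 1)"
  let ?c = "\<Prod>i=1..g+1. I i * V i"
  obtain k where k: "g = Suc (Suc k)" using g by (metis add_2_eq_Suc le_Suc_ex)
  have y_eq: "y = I 1 * V 1 * ?k2"
  proof -
    have "I 1 * V 1 / y * ?k2 - 1 = 0"
      using phi unfolding phi_1_eq[OF g] by simp
    then show ?thesis using y by (metis eq_iff_diff_eq_0 nonzero_eq_divide_eq times_divide_eq_left mult_1)
  qed
  \<comment> \<open>In the Desnanot-Jacobi identity the determinant of the full block on
    \<open>1, ..., g\<close> is zero here, so one product drops out.\<close>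
  have "?k1 * ?k2 = (\<Prod>i<g-1. I (2 + i) * V (2 + i))"
    using continuant_det_identity[of "\<lambda>i. x + I (Suc i) + V i" "\<lambda>i. I i * V i" 1 k] root
    by (simp add: toda_block_def k numeral_2_eq_2)
  then have c: "?c = y * (I (g + 1) * V (g + 1) * ?k1)"
    unfolding prod_toda_split[OF g] y_eq by (simp add: mult_ac)
  have w: "?c / y = I (g + 1) * V (g + 1) * ?k1"
    using y unfolding c by simp
  show "toda_trace g (I(1 := - I 1)) V x = q" "toda_trace g I (V(g + 1 := - V (g + 1))) x = - q"
    unfolding toda_trace_flip_first[OF g] toda_trace_flip_last[OF g] root q_def w y_eq[symmetric]
    by simp_all
  \<comment> \<open>The squares of \<open>y + ?c / y\<close> and \<open>y - ?c / y\<close> differ by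
    \<open>4 * ?c\<close>, which puts the image under \<open>rho\<close> on the spectral
    curve.\<close>
  have t: "toda_trace g I V x = - y - ?c / y"
    unfolding toda_trace_def root w y_eq[symmetric] by simp
  show "q\<^sup>2 = (toda_trace g I V x)\<^sup>2 - 4 * ?c"
    unfolding t q_def using y by (simp add: power2_eq_square algebra_simps)
qed

section \<open>The value of the spectral polynomial at zero\<close>

lemma toda_block_Suc_Suc:
  "toda_block I V x a (Suc (Suc n)) = (x + I (Suc (a + Suc n)) + V (a + Suc n)) * toda_block I V x a (Suc n)
     - I (a + Suc n) * V (a + Suc n) * toda_block I V x a n"
  by (simp add: toda_block_def)

text \<open>At \<open>x = 0\<close> the sum \<open>I + V\<close> on the diagonal splits: the part
  with \<open>I\<close> is what is subtracted, and the difference gains one factor \<open>V\<close>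
  per step.\<close>

lemma toda_block_at_0_right:
  "toda_block I V 0 a (Suc n) - I (Suc (a + n)) * toda_block I V 0 a n = (\<Prod>i<Suc n. V (a + i))"
proof (induction n)
  case 0
  show ?case by (simp add: toda_block_def)
next
  case (Suc n)
  have "toda_block I V 0 a (Suc (Suc n)) - I (Suc (a + Suc n)) * toda_block I V 0 a (Suc n) =
    V (a + Suc n) * (toda_block I V 0 a (Suc n) - I (Suc (a + n)) * toda_block I V 0 a n)"
    unfolding toda_block_Suc_Suc by (simp add: algebra_simps)
  then show ?case unfolding Suc by (simp add: mult.commute)
qed

text \<open>Both blocks end at the same index and obey the same recursion in it, hence so does the
  difference. This calls for a two-step induction, where the terms with \<open>V\<close>
  cancel.\<close>

lemma toda_block_at_0_left:
  "toda_block I V 0 a (Suc n) - V a * toda_block I V 0 (Suc a) n = (\<Prod>i<Suc n. I (Suc a + i))"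
proof (induction n rule: induct_nat_012)
  case 0
  show ?case by (simp add: toda_block_def)
next
  case 1
  show ?case by (simp add: toda_block_def algebra_simps)
next
  case (ge2 n)
  let ?X = "\<lambda>n. toda_block I V 0 a (Suc n) - V a * toda_block I V 0 (Suc a) n"
  have "?X (Suc (Suc n)) = (I (Suc (Suc (Suc (a + n)))) + V (Suc (Suc (a + n)))) * ?X (Suc n)
      - I (Suc (Suc (a + n))) * V (Suc (Suc (a + n))) * ?X n"
    unfolding toda_block_Suc_Suc[of _ _ _ a "Suc n"] toda_block_Suc_Suc[of _ _ _ "Suc a" n]
    by (simp add: algebra_simps)
  also have "\<dots> = I (Suc (Suc (Suc (a + n)))) * (\<Prod>i<Suc (Suc n). I (Suc a + i))"
    unfolding ge2 by (simp add: algebra_simps)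
  finally show ?case by (simp add: algebra_simps)
qed

text \<open>The trace regroups into \<open>V (g + 1)\<close> times the first difference above plus
  \<open>I 1\<close> times the second.\<close>

lemma toda_trace_at_0:
  fixes I V :: "nat \<Rightarrow> 'a::comm_ring_1"
  assumes "g \<ge> 1"
  shows "toda_trace g I V 0 = (\<Prod>i=1..g+1. I i) + (\<Prod>i=1..g+1. V i)"
proof -
  obtain k where g: "g = Suc k" using assms by (cases g) auto
  have shift: "(\<Prod>i=1..g+1. f i) = (\<Prod>i<Suc g. f (Suc i))" for f :: "nat \<Rightarrow> 'a"
    by (rule prod.reindex_bij_witness[of _ Suc "\<lambda>i. i - 1"]) auto
  have "toda_trace g I V 0 =
      V (g + 1) * (toda_block I V 0 1 (Suc k) - I (Suc (1 + k)) * toda_block I V 0 1 k)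
      + I 1 * (toda_block I V 0 1 (Suc k) - V 1 * toda_block I V 0 (Suc 1) k)"
    unfolding toda_trace_def by (simp add: g algebra_simps flip: numeral_2_eq_2)
  also have "\<dots> = (\<Prod>i<g. V (Suc i)) * V (g + 1) + I 1 * (\<Prod>i<g. I (Suc (Suc i)))"
    unfolding toda_block_at_0_right toda_block_at_0_left by (simp add: g mult.commute)
  also have "\<dots> = (\<Prod>i=1..g+1. V i) + (\<Prod>i=1..g+1. I i)"
    unfolding shift[of I] prod.lessThan_Suc_shift[of _ g] unfolding shift[of V] by simp
  finally show ?thesis by (simp add: add.commute)
qed

section \<open>Local expansions on the curve\<close>

abbreviation fps_poly :: "'a::comm_ring_1 poly \<Rightarrow> 'a fps \<Rightarrow> 'a fps" where
  "fps_poly G S \<equiv> poly (map_poly fps_const G) S"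

abbreviation fls_poly :: "'a::comm_ring_1 poly \<Rightarrow> 'a fls \<Rightarrow> 'a fls" where
  "fls_poly G u \<equiv> poly (map_poly fls_const G) u"

lemma fps_poly_pCons [simp]: "fps_poly (pCons c G) S = fps_const c + S * fps_poly G S"
  by (cases "c = 0 \<and> G = 0") (simp_all add: Polynomial.map_poly_pCons)

lemma fls_poly_pCons [simp]: "fls_poly (pCons c G) u = fls_const c + u * fls_poly G u"
  by (cases "c = 0 \<and> G = 0") (simp_all add: Polynomial.map_poly_pCons)

lemma fps_poly_add: "fps_poly (A + B) S = fps_poly A S + fps_poly B S"
proof (induction A B rule: poly_induct2)
  case (pCons a p b q)
  then show ?case by (simp add: algebra_simps flip: fps_const_add)
qed simp

lemma fps_poly_smult: "fps_poly (Polynomial.smult c A) S = fps_const c * fps_poly A S"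
  by (induction A) (simp_all add: algebra_simps flip: fps_const_mult)

lemma fps_poly_mult: "fps_poly (A * B) S = fps_poly A S * fps_poly B S"
  by (induction A) (simp_all add: fps_poly_add fps_poly_smult algebra_simps)

lemma fps_poly_power: "fps_poly (A ^ n) S = fps_poly A S ^ n"
  by (induction n) (simp_all add: fps_poly_mult one_pCons)

lemma fls_poly_add: "fls_poly (A + B) S = fls_poly A S + fls_poly B S"
proof (induction A B rule: poly_induct2)
  case (pCons a p b q)
  then show ?case by (simp add: algebra_simps flip: fls_plus_const)
qed simp

lemma fls_poly_smult: "fls_poly (Polynomial.smult c A) S = fls_const c * fls_poly A S"
  by (induction A) (simp_all add: algebra_simps flip: fls_const_mult_const)

lemma fls_poly_mult: "fls_poly (A * B) S = fls_poly A S * fls_poly B S"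
  by (induction A) (simp_all add: fls_poly_add fls_poly_smult algebra_simps)

lemma fps_poly_nth_0: "fps_poly G S $ 0 = poly G (S $ 0)"
  by (induction G) simp_all

text \<open>The chain rule to first order, which links the derivative in
  \<open>nonsingular_curve\<close> to the tangent vector in \<open>local_param\<close>.\<close>

lemma fps_poly_nth_1: "fps_poly G S $ 1 = poly (pderiv G) (S $ 0) * S $ 1"
  by (induction G) (simp_all add: fps_mult_nth fps_poly_nth_0 pderiv_pCons algebra_simps)

lemma fps_to_fls_poly: "fps_to_fls (fps_poly G S) = fls_poly G (fps_to_fls S)"
  by (induction G) (simp_all add: fls_times_fps_to_fls)

lemma fps_poly_compose:
  fixes R :: "'a::idom fps"
  assumes "R $ 0 = 0"
  shows "fps_poly G S oo R = fps_poly G (S oo R)"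
  by (induction G) (simp_all add: fps_compose_add_distrib fps_compose_mult_distrib[OF assms])

text \<open>A nonconstant series is transcendental over the constants. After all factors vanishing
  at the starting point are split off, the rest has a nonzero constant term.\<close>

lemma fps_poly_nonzero:
  fixes S :: "'a::field fps"
  assumes S: "S \<noteq> fps_const (S $ 0)" and n: "n \<noteq> 0"
  shows "fps_poly n S \<noteq> 0"
proof -
  obtain r where r: "n = [:- (S $ 0), 1:] ^ order (S $ 0) n * r" "\<not> [:- (S $ 0), 1:] dvd r"
    using order_decomp[OF n] by blast
  have "fps_poly r S $ 0 \<noteq> 0"
    using r(2) by (simp add: fps_poly_nth_0 poly_eq_0_iff_dvd)
  then have "fps_poly r S \<noteq> 0" by auto
  moreover have "fps_poly [:- (S $ 0), 1:] S \<noteq> 0"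
    using S by (simp add: add_eq_0_iff flip: fps_const_neg)
  ultimately show ?thesis
    by (subst r(1)) (simp add: fps_poly_mult fps_poly_power)
qed

section \<open>Existence and use of local parametrizations\<close>

text \<open>If \<open>S\<close> were constant, then so would be the square of \<open>W\<close>.
  Since the tangent vector is nonzero, \<open>W\<close> would start at zero, so its square, and
  hence \<open>W\<close>, would vanish.\<close>

lemma local_param_nonconstant:
  assumes "local_param G p q S W"
  shows "S \<noteq> fps_const (S $ 0)"
proof
  assume S: "S = fps_const (S $ 0)"
  have W2: "W * W = fps_poly G S" and t: "S $ 1 \<noteq> 0 \<or> W $ 1 \<noteq> 0"
    using assms by (auto simp: local_param_def power2_eq_square)
  have S1: "S $ 1 = 0" by (subst S) simp
  have "fps_poly G S = fps_const (poly G (S $ 0))"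
    by (subst S, induction G) simp_all
  then have WW: "W * W = fps_const (poly G (S $ 0))" using W2 by simp
  have "(W * W) $ 1 = 0" unfolding WW by simp
  then have "W $ 0 * W $ 1 = 0" by (simp add: fps_mult_nth)
  then have "W $ 0 = 0" using t S1 by auto
  moreover from this have "W * W = 0"
    unfolding WW using arg_cong[OF WW, of "\<lambda>f. fps_nth f 0"] by simp
  ultimately show False using t S1 by simp
qed

text \<open>A formal implicit function theorem: for nonzero \<open>q\<close> the shifted first
  coordinate is the parameter, otherwise the second coordinate is.\<close>

lemma local_param_exists:
  assumes on: "q\<^sup>2 = poly G p" and smooth: "\<not> (2 * q = 0 \<and> poly (pderiv G) p = 0)"
  shows "\<exists>S W. local_param G p q S W"
proof (cases "q = 0")
  case False
  define S where "S = fps_const p + fps_X"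
  \<comment> \<open>The square root with constant term \<open>q\<close>; the first argument of
    \<open>fps_radical\<close> selects the root of the constant coefficient.\<close>
  define W where "W = fps_radical (\<lambda>_ _. q) (Suc 1) (fps_poly G S)"
  have "fps_poly G S $ 0 = q\<^sup>2" by (simp add: fps_poly_nth_0 S_def on)
  then have "W ^ Suc 1 = fps_poly G S"
    unfolding W_def using False by (subst power_radical[symmetric]) (simp_all add: power2_eq_square)
  moreover have "W $ 0 = q" by (simp add: W_def)
  ultimately show ?thesis
    by (intro exI[of _ S] exI[of _ W]) (simp add: local_param_def S_def power2_eq_square)
next
  case True
  define a where "a = fps_poly G (fps_const p + fps_X)"
  have a0: "a $ 0 = 0" using on True by (simp add: a_def fps_poly_nth_0)
  have a1: "a $ 1 \<noteq> 0" using smooth True by (simp add: a_def fps_poly_nth_1[unfolded One_nat_def])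
  \<comment> \<open>At a branch point \<open>w\<close> itself is a local parameter.\<close>
  define R where "R = fps_inv a oo fps_X\<^sup>2"
  have R0: "R $ 0 = 0" by (simp add: R_def fps_inv_def)
  have "fps_poly G (fps_const p + R) = a oo R"
    using R0 by (simp add: a_def fps_poly_compose[OF R0] fps_compose_add_distrib fps_X_fps_compose_startby0)
  also have "\<dots> = fps_X\<^sup>2"
    unfolding R_def using fps_inv_right[OF a0 a1]
    by (subst fps_compose_assoc) (simp_all add: fps_inv_def fps_X_fps_compose_startby0)
  finally show ?thesis
    using R0 True by (intro exI[of _ "fps_const p + R"] exI[of _ fps_X]) (simp add: local_param_def)
qed

text \<open>The leading coefficient 1 becomes the constant term of the reflected polynomial, so the
  curve passes through \<open>(0, e)\<close> and is smooth there because \<open>e\<close> is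
  nonzero.\<close>

lemma expansion_at_infinity_exists:
  assumes "lead_coeff F = 1" and "e\<^sup>2 = 1"
  shows "\<exists>u v. expansion_at_infinity g F e u v"
proof -
  have "poly (reflect_poly F) 0 = 1" by (simp add: poly_0_coeff_0 assms)
  then have "\<exists>S W. local_param (reflect_poly F) 0 e S W"
    by (intro local_param_exists) (use assms in auto)
  then show ?thesis by (auto simp: expansion_at_infinity_def)
qed

text \<open>Replaces the choice inside \<open>ord_at\<close> by one expansion serving all functions
  at once.\<close>

lemma ord_at_witness:
  assumes F: "lead_coeff F = 1" and ns: "nonsingular_curve F" and P: "P \<in> curve_points F"
  obtains u v where "local_expansion g F P u v"
    and "\<And>h. ord_at g F P h = fls_subdegree (eval_fract (fst h) u + eval_fract (snd h) u * v)"
proof -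
  have "\<exists>u v. local_expansion g F P u v"
  proof (cases P)
    case (Affine p q)
    then have "q\<^sup>2 = poly F p" using P by (auto simp: curve_points_def)
    then have "\<exists>S W. local_param F p q S W"
      using ns unfolding nonsingular_curve_def by (blast intro: local_param_exists)
    then show ?thesis by (auto simp: Affine)
  qed (use expansion_at_infinity_exists[OF F, of _ g] in auto)
  then have "\<exists>x. case x of (u, v) \<Rightarrow> local_expansion g F P u v" by auto
  then have "case (SOME (u, v). local_expansion g F P u v) of (u, v) \<Rightarrow> local_expansion g F P u v"
    by (rule someI_ex)
  then show ?thesis
    by (intro that[of "fst (SOME (u, v). local_expansion g F P u v)" "snd (SOME (u, v). local_expansion g F P u v)"])
       (auto simp: ord_at_def case_prod_beta)
qed

section \<open>Functions without finite poles\<close>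

text \<open>\<open>eval_fract\<close> uses a chosen quotient; cross-multiplication shows that every
  other representative has the same value.\<close>

lemma eval_fract_quotient:
  assumes u: "\<And>n. n \<noteq> 0 \<Longrightarrow> fls_poly n u \<noteq> 0" and d: "d \<noteq> 0"
  shows "eval_fract (to_fract A / to_fract d) u = fls_poly A u / fls_poly d u"
proof -
  define n m where "n = fst (quot_of_fract (to_fract A / to_fract d))"
    and "m = snd (quot_of_fract (to_fract A / to_fract d))"
  have m: "m \<noteq> 0" by (simp add: m_def)
  have "Fract n m = Fract A d" by (simp add: n_def m_def Fract_conv_to_fract[of A d])
  then have "n * d = A * m" using m d by (simp add: eq_fract)
  then have "fls_poly n u * fls_poly d u = fls_poly A u * fls_poly m u"
    by (simp flip: fls_poly_mult)
  then have "fls_poly n u / fls_poly m u = fls_poly A u / fls_poly d u"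
    using u[OF m] u[OF d] by (simp add: frac_eq_eq)
  then show ?thesis by (simp add: eval_fract_def n_def m_def case_prod_beta)
qed

lemma eval_fract_to_fract: "eval_fract (to_fract A) u = fls_poly A u"
  by (simp add: eval_fract_def one_pCons)

lemma eval_affine:
  assumes loc: "local_param F p q S W" and d: "d \<noteq> 0"
  shows "eval_fract (to_fract A / to_fract d) (fps_to_fls S)
      + eval_fract (to_fract B / to_fract d) (fps_to_fls S) * fps_to_fls W
    = fps_to_fls (fps_poly A S + fps_poly B S * W) / fps_to_fls (fps_poly d S)"
proof -
  have u: "fls_poly n (fps_to_fls S) \<noteq> 0" if "n \<noteq> 0" for n
    using fps_poly_nonzero[OF local_param_nonconstant[OF loc] that] by (simp flip: fps_to_fls_poly)
  show ?thesis
    using u[OF d] by (simp add: eval_fract_quotient[OF u d] fps_to_fls_poly fls_times_fps_to_fls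
        add_divide_distrib)
qed

text \<open>Regularity makes the expansion of the numerator a multiple of that of \<open>d\<close>,
  and the constant coefficient gives the first claim. At a branch point the tangent is vertical, so
  the linear coefficient isolates the value of \<open>B\<close>.\<close>

lemma regular_at_pole_of_denominator:
  assumes F: "lead_coeff F = 1" "nonsingular_curve F" and d: "d \<noteq> 0" "poly d p = 0"
    and q: "q\<^sup>2 = poly F p"
    and ord: "ord_at g F (Affine p q) (to_fract A / to_fract d, to_fract B / to_fract d) \<ge> 0"
  shows "poly A p + poly B p * q = 0" and "q = 0 \<Longrightarrow> poly B p = 0"
proof -
  have "Affine p q \<in> curve_points F" using q by (simp add: curve_points_def)
  then obtain u v where uv: "local_expansion g F (Affine p q) u v"
    and o: "\<And>h. ord_at g F (Affine p q) h = fls_subdegree (eval_fract (fst h) u + eval_fract (snd h) u * v)"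
    using ord_at_witness[OF F] by metis
  then obtain S W where loc: "local_param F p q S W" and u: "u = fps_to_fls S" and v: "v = fps_to_fls W"
    by auto
  let ?X = "fps_to_fls (fps_poly A S + fps_poly B S * W) / fps_to_fls (fps_poly d S)"
  have "fls_subdegree ?X \<ge> 0"
    using ord unfolding o u v fst_conv snd_conv eval_affine[OF loc d(1)] .
  then obtain x where x: "?X = fps_to_fls x" by (metis fls_regpart_to_fls_trivial)
  have "fps_poly d S \<noteq> 0" by (rule fps_poly_nonzero[OF local_param_nonconstant[OF loc] d(1)])
  then have "fps_to_fls (fps_poly A S + fps_poly B S * W) = fps_to_fls (x * fps_poly d S)"
    using x by (simp add: field_simps fls_times_fps_to_fls)
  then have eq: "fps_poly A S + fps_poly B S * W = x * fps_poly d S"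
    by (simp only: fps_to_fls_eq_iff)
  have S0: "fps_nth S 0 = p" and W0: "fps_nth W 0 = q" and W2: "W\<^sup>2 = fps_poly F S"
    and t: "fps_nth S 1 \<noteq> 0 \<or> fps_nth W 1 \<noteq> 0"
    using loc by (auto simp: local_param_def)
  show A: "poly A p + poly B p * q = 0"
    using arg_cong[OF eq, of "\<lambda>f. fps_nth f 0"] by (simp add: fps_poly_nth_0 S0 W0 d)
  assume q0: "q = 0"
  have "poly (pderiv F) p \<noteq> 0"
    using F(2) q q0 unfolding nonsingular_curve_def by force
  moreover have "poly (pderiv F) p * fps_nth S 1 = 0"
    using arg_cong[OF W2, of "\<lambda>f. fps_nth f 1"] W0 q0
    by (simp add: fps_poly_nth_1[unfolded One_nat_def] S0 power2_eq_square fps_mult_nth)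
  ultimately have S1: "fps_nth S 1 = 0" by simp
  have "poly B p * fps_nth W 1 = 0"
    using arg_cong[OF eq, of "\<lambda>f. fps_nth f 1"] S1 W0 q0
    by (simp add: fps_poly_nth_1[unfolded One_nat_def] fps_poly_nth_0 S0 fps_mult_nth d)
  then show "poly B p = 0" using t S1 by simp
qed

text \<open>The conjugate points \<open>(p, q)\<close> and \<open>(p, - q)\<close> give two linear
  equations for the values of \<open>A\<close> and \<open>B\<close>. They coincide for
  \<open>q = 0\<close>, where the branch point condition takes over.\<close>

lemma denominator_root_cancels:
  assumes F: "lead_coeff F = 1" "nonsingular_curve F" and d: "d \<noteq> 0" "poly d p = 0"
    and ord: "\<And>q. q\<^sup>2 = poly F p \<Longrightarrow>
      ord_at g F (Affine p q) (to_fract A / to_fract d, to_fract B / to_fract d) \<ge> 0"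
  shows "poly A p = 0 \<and> poly B p = 0"
proof -
  define q where "q = csqrt (poly F p)"
  have q: "q\<^sup>2 = poly F p" "(- q)\<^sup>2 = poly F p" by (simp_all add: q_def)
  note R = regular_at_pole_of_denominator[OF F d q(1) ord[OF q(1)]]
    and R' = regular_at_pole_of_denominator(1)[OF F d q(2) ord[OF q(2)]]
  show ?thesis
  proof (cases "q = 0")
    case True
    then show ?thesis using R by simp
  next
    case False
    have "2 * (poly B p * q) = (poly A p + poly B p * q) - (poly A p + poly B p * (- q))" by simp
    also have "\<dots> = 0" using R(1) R' by simp
    finally have "poly B p = 0" using False by simp
    then show ?thesis using R(1) by simp
  qed
qed

text \<open>The coordinate ring of a nonsingular affine curve contains every function that is
  regular on it.\<close>

lemma regular_imp_polynomial:
  assumes F: "lead_coeff F = 1" "nonsingular_curve F"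
    and ord: "\<And>p q. q\<^sup>2 = poly F p \<Longrightarrow> ord_at g F (Affine p q) h \<ge> 0"
  shows "\<exists>a b. h = (to_fract a, to_fract b)"
proof -
  \<comment> \<open>A common denominator of least degree has no roots, since they would cancel.\<close>
  define rep where "rep = (\<lambda>(A, B, d). d \<noteq> 0 \<and> h = (to_fract A / to_fract d, to_fract B / to_fract d))"
  obtain n1 d1 where 1: "fst h = to_fract n1 / to_fract d1" "d1 \<noteq> 0"
    by (metis Fract_conv_to_fract Fract_quot_of_fract snd_quot_of_fract_nonzero)
  obtain n2 d2 where 2: "snd h = to_fract n2 / to_fract d2" "d2 \<noteq> 0"
    by (metis Fract_conv_to_fract Fract_quot_of_fract snd_quot_of_fract_nonzero)
  have "rep (n1 * d2, n2 * d1, d1 * d2)"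
    using 1 2 by (simp add: rep_def prod_eq_iff)
  then obtain x where x: "rep x" and min: "\<And>y. rep y \<Longrightarrow> degree (snd (snd x)) \<le> degree (snd (snd y))"
    using ex_has_least_nat[of rep _ "\<lambda>y. degree (snd (snd y))"] by blast
  obtain A B d where ABd: "x = (A, B, d)" by (cases x)
  have d: "d \<noteq> 0" and h: "h = (to_fract A / to_fract d, to_fract B / to_fract d)"
    using x by (auto simp: rep_def ABd)
  have "degree d = 0"
  proof (rule ccontr)
    assume "degree d \<noteq> 0"
    then obtain p where p: "poly d p = 0"
      using alg_closed_imp_poly_has_root[of d] by auto
    have "poly A p = 0 \<and> poly B p = 0"
      by (rule denominator_root_cancels[OF F d p]) (use ord h in auto)
    then obtain A' B' d' where f: "A = [:- p, 1:] * A'" "B = [:- p, 1:] * B'" "d = [:- p, 1:] * d'"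
      using p by (metis poly_eq_0_iff_dvd dvdE)
    have "to_fract ([:- p, 1:]) \<noteq> 0" by simp
    moreover have d': "d' \<noteq> 0" using d f by auto
    ultimately have "rep (A', B', d')"
      unfolding rep_def h f to_fract_mult by (simp del: to_fract_eq_0_iff)
    then have "degree d \<le> degree d'" using min by (force simp: ABd)
    moreover have "degree d = 1 + degree d'"
      unfolding f(3) using d' by (subst degree_mult_eq) auto
    ultimately show False by simp
  qed
  then obtain c where c: "d = [:c:]" by (rule degree_eq_zeroE)
  have "to_fract X / to_fract [:c:] = to_fract (Polynomial.smult (1 / c) X)" for X
  proof -
    have "X = [:c:] * Polynomial.smult (1 / c) X" using d c by simp
    then have "to_fract X = to_fract [:c:] * to_fract (Polynomial.smult (1 / c) X)"
      by (metis to_fract_mult)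
    then show ?thesis using d c by simp
  qed
  then show ?thesis unfolding h c by blast
qed

section \<open>Pole orders at infinity\<close>

text \<open>\<open>R\<close> is the reversed polynomial at \<open>S\<close>, padded to degree
  \<open>N\<close>. The slack in \<open>N\<close> lets \<open>a(u)\<close> and \<open>b(u) v\<close>
  share one denominator.\<close>

lemma fls_poly_at_inverse:
  fixes S :: "complex fps"
  assumes S0: "fps_nth S 0 = 0" and S: "S \<noteq> 0" and deg: "degree a \<le> N"
  shows "\<exists>R. fls_poly a (inverse (fps_to_fls S)) = fps_to_fls R / fps_to_fls S ^ N \<and>
    fps_nth R 0 = coeff a N"
  using deg
proof (induction N arbitrary: a)
  case 0
  then obtain c where "a = [:c:]" using degree_eq_zeroE by auto
  then show ?case by (intro exI[of _ "fps_const c"]) simp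
next
  case (Suc N)
  obtain c a' where a: "a = pCons c a'" by (cases a)
  have "degree a' \<le> N" using Suc.prems unfolding a by (cases "a' = 0") auto
  then obtain R where R: "fls_poly a' (inverse (fps_to_fls S)) = fps_to_fls R / fps_to_fls S ^ N"
    "fps_nth R 0 = coeff a' N" using Suc.IH by blast
  have "fls_poly a (inverse (fps_to_fls S)) =
      fls_const c + inverse (fps_to_fls S) * (fps_to_fls R / fps_to_fls S ^ N)"
    by (simp only: a fls_poly_pCons R(1))
  also have "\<dots> = fps_to_fls (fps_const c * S ^ Suc N + R) / fps_to_fls S ^ Suc N"
    using S by (simp add: fls_times_fps_to_fls fps_to_fls_power field_simps)
  finally have "fls_poly a (inverse (fps_to_fls S)) =
      fps_to_fls (fps_const c * S ^ Suc N + R) / fps_to_fls S ^ Suc N" .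
  moreover have "fps_nth (fps_const c * S ^ Suc N + R) 0 = coeff a (Suc N)"
    by (simp add: a R(2) S0)
  ultimately show ?case by blast
qed

text \<open>Here \<open>u\<close> has a simple pole and \<open>v\<close> one of order
  \<open>g + 1\<close>; \<open>R\<close> is the numerator over the common power of \<open>S\<close>.
  The case \<open>R = 0\<close> is separate because the zero series has subdegree 0.\<close>

lemma ord_at_infinity:
  assumes F: "lead_coeff F = 1" "nonsingular_curve F"
    and P: "P = Inf_plus \<and> e = 1 \<or> P = Inf_minus \<and> e = - 1"
    and deg: "degree a \<le> M + (g + 1)" "degree b \<le> M"
  obtains R where "fps_nth R 0 = coeff a (M + (g + 1)) + e * coeff b M"
    and "ord_at g F P (to_fract a, to_fract b)
      = (if R = 0 then 0 else int (subdegree R) - int (M + (g + 1)))"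
proof -
  have "P \<in> curve_points F" using P by (auto simp: curve_points_def)
  then obtain u v where uv: "local_expansion g F P u v"
    and o: "\<And>h. ord_at g F P h = fls_subdegree (eval_fract (fst h) u + eval_fract (snd h) u * v)"
    using ord_at_witness[OF F] by metis
  then obtain S W where loc: "local_param (reflect_poly F) 0 e S W"
    and u: "u = inverse (fps_to_fls S)" and v: "v = fps_to_fls W / fps_to_fls S ^ (g + 1)"
    using P by (auto simp: expansion_at_infinity_def)
  have S0: "fps_nth S 0 = 0" and W0: "fps_nth W 0 = e" and W2: "W\<^sup>2 = fps_poly (reflect_poly F) S"
    and t: "fps_nth S 1 \<noteq> 0 \<or> fps_nth W 1 \<noteq> 0"
    using loc by (auto simp: local_param_def)
  \<comment> \<open>As \<open>W\<close> starts at the nonzero value \<open>e\<close>, a vanishing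
    linear term of \<open>S\<close> would force one of \<open>W\<close> and leave no tangent
    vector.\<close>
  have S1: "fps_nth S 1 \<noteq> 0"
  proof
    assume "fps_nth S 1 = 0"
    moreover from this have "e * fps_nth W 1 = 0"
      using arg_cong[OF W2, of "\<lambda>f. fps_nth f 1"] W0
      by (simp add: fps_poly_nth_1[unfolded One_nat_def] power2_eq_square fps_mult_nth)
    ultimately show False using t P by auto
  qed
  then have S: "S \<noteq> 0" by auto
  have "subdegree S = 1" using S0 S1 by (intro subdegreeI) auto
  then have sub: "fls_subdegree (fps_to_fls S ^ n) = int n" for n
    using S by (simp add: fls_subdegree_pow fls_subdegree_fls_to_fps)
  obtain A where A: "fls_poly a u = fps_to_fls A / fps_to_fls S ^ (M + (g + 1))"
      "fps_nth A 0 = coeff a (M + (g + 1))"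
    using fls_poly_at_inverse[OF S0 S deg(1)] u by auto
  obtain B where B: "fls_poly b u = fps_to_fls B / fps_to_fls S ^ M" "fps_nth B 0 = coeff b M"
    using fls_poly_at_inverse[OF S0 S deg(2)] u by auto
  have "fls_poly a u + fls_poly b u * v = fps_to_fls (A + B * W) / fps_to_fls S ^ (M + (g + 1))"
    unfolding A(1) B(1) v using S
    by (simp add: fls_times_fps_to_fls power_add add_divide_distrib)
  then have "ord_at g F P (to_fract a, to_fract b)
      = fls_subdegree (fps_to_fls (A + B * W) / fps_to_fls S ^ (M + (g + 1)))"
    by (simp add: o eval_fract_to_fract)
  also have "\<dots> = (if A + B * W = 0 then 0 else int (subdegree (A + B * W)) - int (M + (g + 1)))"
  proof (cases "A + B * W = 0")
    case False
    then have "fls_subdegree (fps_to_fls (A + B * W) / fps_to_fls S ^ (M + (g + 1))) =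
      fls_subdegree (fps_to_fls (A + B * W)) - fls_subdegree (fps_to_fls S ^ (M + (g + 1)))"
      using S by (intro fls_divide_subdegree) (simp_all del: fps_to_fls_plus)
    then show ?thesis using False by (simp only: sub fls_subdegree_fls_to_fps if_False)
  qed simp
  finally have o: "ord_at g F P (to_fract a, to_fract b) =
    (if A + B * W = 0 then 0 else int (subdegree (A + B * W)) - int (M + (g + 1)))" .
  show ?thesis
    by (rule that[OF _ o]) (simp add: A(2) B(2) W0 mult.commute)
qed

section \<open>The linear system\<close>

text \<open>A pole of order above \<open>g + 1\<close> is forbidden at both points at infinity, and
  the two leading terms \<open>a + b\<close> and \<open>a - b\<close> cannot both cancel. Where only
  order \<open>g\<close> is allowed, the leading term has to cancel.\<close>

lemma L_space_affine_linear:
  assumes F: "lead_coeff F = 1" "nonsingular_curve F"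
    and h: "h \<in> L_space g F D" "h \<noteq> (0, 0)"
    and D: "\<And>p q. Poly_Mapping.lookup D (Affine p q) = 0"
      "Poly_Mapping.lookup D Inf_plus \<le> int g + 1" "Poly_Mapping.lookup D Inf_minus \<le> int g + 1"
  obtains a \<beta> where "h = (to_fract a, to_fract [:\<beta>:])" "degree a \<le> g + 1"
    and "Poly_Mapping.lookup D Inf_plus \<le> int g \<Longrightarrow> coeff a (g + 1) + \<beta> = 0"
    and "Poly_Mapping.lookup D Inf_minus \<le> int g \<Longrightarrow> coeff a (g + 1) - \<beta> = 0"
proof -
  have ord: "ord_at g F P h + Poly_Mapping.lookup D P \<ge> 0" if "P \<in> curve_points F" for P
    using h that by (auto simp: L_space_def)
  have "ord_at g F (Affine p q) h \<ge> 0" if "q\<^sup>2 = poly F p" for p q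
    using ord[of "Affine p q"] that D(1)[of p q] by (simp add: curve_points_def)
  then obtain a b where hab: "h = (to_fract a, to_fract b)"
    using regular_imp_polynomial[OF F] by blast
  \<comment> \<open>The least \<open>M\<close> satisfying both degree bounds below; the truncated
    subtraction makes it 0 when both degrees are small.\<close>
  define M where "M = max (degree b) (degree a - (g + 1))"
  have deg: "degree a \<le> M + (g + 1)" "degree b \<le> M" by (auto simp: M_def)
  have lead: "coeff a (M + (g + 1)) + e * coeff b M = 0"
    if P: "P = Inf_plus \<and> e = 1 \<or> P = Inf_minus \<and> e = - 1"
      and l: "Poly_Mapping.lookup D P < int (M + (g + 1))" for P e
  proof -
    obtain R where R: "fps_nth R 0 = coeff a (M + (g + 1)) + e * coeff b M"
      "ord_at g F P (to_fract a, to_fract b)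
        = (if R = 0 then 0 else int (subdegree R) - int (M + (g + 1)))"
      using ord_at_infinity[OF F P deg] by blast
    have "R = 0 \<or> subdegree R > 0"
      using ord[of P] P l R(2) unfolding hab curve_points_def by (auto split: if_splits)
    then have "fps_nth R 0 = 0" by auto
    then show ?thesis by (simp only: R(1))
  qed
  have "M = 0"
  proof (rule ccontr)
    assume M: "M \<noteq> 0"
    then have l: "coeff a (M + (g + 1)) + 1 * coeff b M = 0" "coeff a (M + (g + 1)) + - 1 * coeff b M = 0"
      using lead[of Inf_plus 1] lead[of Inf_minus "- 1"] D by auto
    have "2 * coeff b M = (coeff a (M + (g + 1)) + 1 * coeff b M) - (coeff a (M + (g + 1)) + - 1 * coeff b M)"
      by simp
    also have "\<dots> = 0" unfolding l by simp
    finally have b: "coeff b M = 0" by simp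
    then have a: "coeff a (M + (g + 1)) = 0" using l(1) by simp
    \<comment> \<open>Minimality: for nonzero \<open>M\<close> one of the bounds is attained, so one
      of the vanishing coefficients is a leading one.\<close>
    have "M = degree b \<or> M + (g + 1) = degree a" using M by (auto simp: M_def max_def)
    then have "b = 0 \<or> a = 0" and "degree b = M \<or> degree a = M + (g + 1)"
      using a b by (metis leading_coeff_0_iff)+
    then show False using a b M by (metis add_is_0 degree_0 leading_coeff_0_iff)
  qed
  then have "degree b = 0" by (simp add: M_def)
  then obtain \<beta> where b: "b = [:\<beta>:]" by (rule degree_eq_zeroE)
  show ?thesis
    by (rule that[of a \<beta>])
       (use hab b deg \<open>M = 0\<close> lead[of Inf_plus 1] lead[of Inf_minus "- 1"] in auto)
qed

lemma affine_linear_in_L_space: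
  assumes F: "lead_coeff F = 1" "nonsingular_curve F"
    and deg: "degree a \<le> g + 1"
    and D: "\<And>p q. Poly_Mapping.lookup D (Affine p q) \<ge> 0"
      "Poly_Mapping.lookup D Inf_plus \<ge> int g" "Poly_Mapping.lookup D Inf_minus \<ge> int g"
    and P: "coeff a (g + 1) + \<beta> = 0 \<or> Poly_Mapping.lookup D Inf_plus \<ge> int g + 1"
      "coeff a (g + 1) - \<beta> = 0 \<or> Poly_Mapping.lookup D Inf_minus \<ge> int g + 1"
  shows "(to_fract a, to_fract [:\<beta>:]) \<in> L_space g F D"
proof -
  have "ord_at g F Q (to_fract a, to_fract [:\<beta>:]) + Poly_Mapping.lookup D Q \<ge> 0"
    if Q: "Q \<in> curve_points F" for Q
  proof (cases "\<exists>p q. Q = Affine p q")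
    case True
    then obtain p q where Qpq: "Q = Affine p q" by auto
    obtain u v where uv: "local_expansion g F Q u v"
      and o: "\<And>h. ord_at g F Q h = fls_subdegree (eval_fract (fst h) u + eval_fract (snd h) u * v)"
      using ord_at_witness[OF F Q] by metis
    then obtain S W where u: "u = fps_to_fls S" and v: "v = fps_to_fls W"
      unfolding Qpq by auto
    have "fls_poly a u + fls_poly [:\<beta>:] u * v = fps_to_fls (fps_poly a S + fps_const \<beta> * W)"
      by (simp add: u v fps_to_fls_poly fls_times_fps_to_fls)
    then have "ord_at g F Q (to_fract a, to_fract [:\<beta>:]) \<ge> 0"
      unfolding o fst_conv snd_conv eval_fract_to_fract by (simp only: fls_subdegree_fls_to_fps_gt0)
    then show ?thesis using D(1)[of p q] unfolding Qpq by simp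
  next
    case False
    define e :: complex where "e = (if Q = Inf_plus then 1 else - 1)"
    have Qe: "Q = Inf_plus \<and> e = 1 \<or> Q = Inf_minus \<and> e = - 1"
      using False Q by (auto simp: e_def curve_points_def)
    obtain R where R: "fps_nth R 0 = coeff a (0 + (g + 1)) + e * coeff [:\<beta>:] 0"
      "ord_at g F Q (to_fract a, to_fract [:\<beta>:])
        = (if R = 0 then 0 else int (subdegree R) - int (0 + (g + 1)))"
      using ord_at_infinity[OF F Qe, of a 0 g "[:\<beta>:]"] deg by auto
    have "Poly_Mapping.lookup D Q \<ge> int g + 1 \<or> fps_nth R 0 = 0"
      using Qe P R(1) by auto
    moreover have "subdegree R > 0" if "fps_nth R 0 = 0" "R \<noteq> 0"
      using that by (metis gr0I subdegree_eq_0_iff)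
    moreover have "Poly_Mapping.lookup D Q \<ge> int g" using Qe D by auto
    ultimately show ?thesis unfolding R(2) by auto
  qed
  then show ?thesis by (auto simp: L_space_def)
qed

text \<open>A root of \<open>a\<close> would be a multiple root of \<open>F\<close>, hence a
  singular point with second coordinate 0. This excludes that \<open>a(u)\<close> plus a nonzero
  multiple of \<open>v\<close> vanishes along a branch.\<close>

lemma nonsingular_not_square:
  assumes ns: "nonsingular_curve F" and deg: "degree F > 0" and \<beta>: "\<beta> \<noteq> 0"
  shows "a\<^sup>2 \<noteq> Polynomial.smult (\<beta>\<^sup>2) F"
proof
  assume eq: "a\<^sup>2 = Polynomial.smult (\<beta>\<^sup>2) F"
  have "degree a \<noteq> 0"
    using arg_cong[OF eq, of degree] deg \<beta> degree_power_le[of a 2] by auto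
  then obtain p where p: "poly a p = 0"
    using alg_closed_imp_poly_has_root[of a] by auto
  have "\<beta>\<^sup>2 * poly F p = 0"
    using arg_cong[OF eq, of "\<lambda>f. poly f p"] p by simp
  moreover have "\<beta>\<^sup>2 * poly (pderiv F) p = 0"
    using arg_cong[OF eq, of "\<lambda>f. poly (pderiv f) p"] p
    by (simp add: power2_eq_square pderiv_mult pderiv_smult)
  ultimately show False using ns \<beta> unfolding nonsingular_curve_def by force
qed

text \<open>The value at the point is the constant term of the expansion. For the second claim the
  expansion must also be nonzero, since the zero series would count as order 0.\<close>

lemma affine_linear_passes_through:
  assumes F: "lead_coeff F = 1" "nonsingular_curve F"
  shows passes_through_imp: "passes_through g F (to_fract a, to_fract [:\<beta>:]) (p, q) \<Longrightarrow> poly a p + \<beta> * q = 0"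
    and passes_throughI: "degree F > 0 \<Longrightarrow> \<beta> \<noteq> 0 \<Longrightarrow> q\<^sup>2 = poly F p \<Longrightarrow> poly a p + \<beta> * q = 0 \<Longrightarrow>
      passes_through g F (to_fract a, to_fract [:\<beta>:]) (p, q)"
proof -
  have ord: "\<exists>S W. local_param F p q S W \<and>
     ord_at g F (Affine p q) (to_fract a, to_fract [:\<beta>:]) = int (subdegree (fps_poly a S + fps_const \<beta> * W))"
    if c: "Affine p q \<in> curve_points F"
  proof -
    obtain u v where uv: "local_expansion g F (Affine p q) u v"
      and o: "\<And>h. ord_at g F (Affine p q) h = fls_subdegree (eval_fract (fst h) u + eval_fract (snd h) u * v)"
      using ord_at_witness[OF F c] by metis
    then obtain S W where l: "local_param F p q S W" and u: "u = fps_to_fls S" and v: "v = fps_to_fls W"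
      by auto
    have "fls_poly a u + fls_poly [:\<beta>:] u * v = fps_to_fls (fps_poly a S + fps_const \<beta> * W)"
      by (simp add: u v fps_to_fls_poly fls_times_fps_to_fls)
    then have "ord_at g F (Affine p q) (to_fract a, to_fract [:\<beta>:]) = int (subdegree (fps_poly a S + fps_const \<beta> * W))"
      unfolding o fst_conv snd_conv eval_fract_to_fract by (simp only: fls_subdegree_fls_to_fps)
    then show ?thesis using l by blast
  qed
  have nth_0: "fps_nth (fps_poly a S + fps_const \<beta> * W) 0 = poly a p + \<beta> * q"
    if "local_param F p q S W" for S W
    using that by (simp add: local_param_def fps_poly_nth_0)
  show "poly a p + \<beta> * q = 0" if "passes_through g F (to_fract a, to_fract [:\<beta>:]) (p, q)"
  proof -
    have c: "Affine p q \<in> curve_points F" and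
      pos: "ord_at g F (Affine p q) (to_fract a, to_fract [:\<beta>:]) > 0"
      using that by (auto simp: passes_through_def)
    obtain S W where "local_param F p q S W" "subdegree (fps_poly a S + fps_const \<beta> * W) > 0"
      using ord[OF c] pos by auto
    then show ?thesis using nth_0 by (metis nth_less_subdegree_zero)
  qed
  show "passes_through g F (to_fract a, to_fract [:\<beta>:]) (p, q)"
    if deg: "degree F > 0" and \<beta>: "\<beta> \<noteq> 0" and q: "q\<^sup>2 = poly F p" and z: "poly a p + \<beta> * q = 0"
  proof -
    have c: "Affine p q \<in> curve_points F" using q by (simp add: curve_points_def)
    obtain S W where l: "local_param F p q S W" and
      o: "ord_at g F (Affine p q) (to_fract a, to_fract [:\<beta>:]) = int (subdegree (fps_poly a S + fps_const \<beta> * W))"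
      using ord[OF c] by auto
    have "fps_poly a S + fps_const \<beta> * W \<noteq> 0"
    proof
      assume "fps_poly a S + fps_const \<beta> * W = 0"
      then have "fps_poly a S = - (fps_const \<beta> * W)" by (simp add: add_eq_0_iff)
      \<comment> \<open>Squaring eliminates \<open>W\<close> through the equation of the
        curve.\<close>
      then have "fps_poly (a\<^sup>2) S = (fps_const \<beta>)\<^sup>2 * W\<^sup>2"
        by (simp add: fps_poly_power power_mult_distrib)
      also have "\<dots> = fps_poly (Polynomial.smult (\<beta>\<^sup>2) F) S"
        using l by (simp add: local_param_def fps_poly_smult fps_const_power)
      finally have "fps_poly (a\<^sup>2 + Polynomial.smult (- 1) (Polynomial.smult (\<beta>\<^sup>2) F)) S = 0"
        by (simp only: fps_poly_add fps_poly_smult[of "- 1"]) (simp flip: fps_const_neg)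
      then have "a\<^sup>2 + Polynomial.smult (- 1) (Polynomial.smult (\<beta>\<^sup>2) F) = 0"
        using fps_poly_nonzero[OF local_param_nonconstant[OF l]] by blast
      then show False using nonsingular_not_square[OF F(2) deg \<beta>, of a] by simp
    qed
    then have "subdegree (fps_poly a S + fps_const \<beta> * W) > 0"
      using nth_0[OF l] z by (metis gr0I subdegree_eq_0_iff)
    then show ?thesis using c \<beta> by (simp add: passes_through_def o)
  qed
qed

section \<open>The function \<open>h\<^sub>1\<close>\<close>

lemma prod_fun_upd_uminus:
  fixes f :: "'b \<Rightarrow> 'a::comm_ring_1"
  assumes "finite A" "j \<in> A"
  shows "(\<Prod>i\<in>A. (f(j := - f j)) i) = - (\<Prod>i\<in>A. f i)"
proof -
  have "(\<Prod>i\<in>A - {j}. (f(j := - f j)) i) = (\<Prod>i\<in>A - {j}. f i)"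
    by (rule prod.cong) auto
  then show ?thesis using prod.remove[OF assms, of f] prod.remove[OF assms, of "f(j := - f j)"] by simp
qed

lemma spectral_poly_eq:
  assumes "g \<ge> 2"
  shows "spectral_poly g I V = (toda_poly g I V)\<^sup>2 - [:4 * (\<Prod>i=1..g+1. I i * V i):]"
  using sum_monom_toda_c[OF assms, of I V]
  by (simp add: spectral_poly_def toda_cm1_eq[OF assms] add.commute)

lemma spectral_poly_degree:
  assumes g: "g \<ge> 2"
  shows "degree (spectral_poly g I V) > 0" and "lead_coeff (spectral_poly g I V) = 1"
proof -
  let ?T = "toda_poly g I V"
  have d: "degree ?T = g + 1" and T1: "lead_coeff ?T = 1"
    using degree_toda_poly[OF g, of I V] by (metis le_degree le_antisym zero_neq_one)+
  then have "degree (?T\<^sup>2) = 2 * (g + 1)"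
    by (subst degree_power_eq) auto
  moreover have "lead_coeff (?T\<^sup>2) = 1" using T1 by (simp add: lead_coeff_power)
  moreover have "degree (?T\<^sup>2 - [:c:]) = degree (?T\<^sup>2)" if "degree (?T\<^sup>2) > 0" for c
    using that degree_add_eq_left[of "[:- c:]" "?T\<^sup>2"] by (simp add: diff_conv_add_uminus del: add_uminus_conv_diff)
  ultimately show "degree (spectral_poly g I V) > 0" "lead_coeff (spectral_poly g I V) = 1"
    by (simp_all add: spectral_poly_eq[OF g] coeff_pCons split: nat.split)
qed

definition h1_poly :: "nat \<Rightarrow> (nat \<Rightarrow> complex) \<Rightarrow> (nat \<Rightarrow> complex) \<Rightarrow> complex poly" where
  "h1_poly g I V = (if even g then toda_poly g (I(1 := - I 1)) V
     else toda_poly g I (V(g + 1 := - V (g + 1))))"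

text \<open>The power of \<open>- 1\<close> merges the parities: the coefficient of \<open>v\<close>
  is -1 for even \<open>g\<close> and 1 for odd \<open>g\<close>.\<close>

lemma h1_eq:
  assumes "g \<ge> 2"
  shows "h1 g I V = (to_fract (h1_poly g I V), to_fract [:(- 1) ^ (g + 1):])"
  using sum_monom_toda_c[OF assms, of "I(1 := - I 1)" V]
    sum_monom_toda_c[OF assms, of I "V(g + 1 := - V (g + 1))"]
  by (simp add: h1_def h1_poly_def s1_c_def t_last_c_def flip: one_pCons)
     (simp flip: to_fract_uminus to_fract_1 add: one_pCons)

text \<open>The constant term of the spectral polynomial's trace is a sum of two products, and a
  sign change flips one of them. The point lies on the curve since the squared sum minus four times
  the product is the squared difference.\<close>

lemma h1_at_A:
  fixes I V :: "nat \<Rightarrow> complex"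
  assumes g: "g \<ge> 2"
  defines "q \<equiv> (\<Prod>i=1..g+1. V i) - (\<Prod>i=1..g+1. I i)"
  shows "poly (h1_poly g I V) 0 + (- 1) ^ (g + 1) * q = 0"
    and "q\<^sup>2 = poly (spectral_poly g I V) 0"
proof -
  have "g \<ge> 1" using g by simp
  note T = toda_trace_at_0[OF this]
  have I: "(\<Prod>i=1..g+1. (I(1 := - I 1)) i) = - (\<Prod>i=1..g+1. I i)"
    by (rule prod_fun_upd_uminus) auto
  have V: "(\<Prod>i=1..g+1. (V(g + 1 := - V (g + 1))) i) = - (\<Prod>i=1..g+1. V i)"
    by (rule prod_fun_upd_uminus) auto
  show "poly (h1_poly g I V) 0 + (- 1) ^ (g + 1) * q = 0"
  proof (cases "even g")
    case True
    then show ?thesis unfolding h1_poly_def q_def by (simp only: if_True poly_toda_poly T I) simp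
  next
    case False
    then show ?thesis unfolding h1_poly_def q_def by (simp only: if_False poly_toda_poly T V) simp
  qed
  show "q\<^sup>2 = poly (spectral_poly g I V) 0"
    unfolding q_def spectral_poly_eq[OF g] poly_diff poly_power poly_toda_poly T prod.distrib
    by (simp add: power2_eq_square algebra_simps)
qed

lemma h1_at_eigenvector_point:
  assumes g: "g \<ge> 2" and P: "eigenvector_map g I V P" and i: "i \<in> {1..g}"
  shows "poly (h1_poly g I V) (fst (P i)) + (- 1) ^ (g + 1) * snd (P i) = 0"
    and "(snd (P i))\<^sup>2 = poly (spectral_poly g I V) (fst (P i))"
proof -
  obtain Q where Q: "eigenvector_points g I V Q" "P i = rho g I V (Q i)"
    using P i by (auto simp: eigenvector_map_def)
  obtain x y where xy: "Q i = (x, y)" by (cases "Q i")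
  \<comment> \<open>The index \<open>i\<close> itself is counted, so the multiplicity is positive;
    this yields the equations at \<open>(x, y)\<close> as well as the root of
    \<open>block_poly\<close>.\<close>
  have "card {i \<in> {1..g}. Q i = (x, y)} \<noteq> 0" using i xy by auto
  moreover have "card {i \<in> {1..g}. Q i = (x, y)} =
      (if y \<noteq> 0 \<and> phi g I V 1 x y = 0 \<and> phi g I V 2 x y = 0 then order x (block_poly g I V) else 0)"
    using Q(1) unfolding eigenvector_points_def by blast
  ultimately have "y \<noteq> 0" "phi g I V 1 x y = 0" and "order x (block_poly g I V) \<noteq> 0"
    by presburger+
  then have "toda_block I V x 1 g = 0"
    using poly_block_poly[OF g] by (metis order_root)
  note E = toda_trace_at_eigenvector_point[OF g \<open>y \<noteq> 0\<close> \<open>phi g I V 1 x y = 0\<close> this]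
  have Pi: "P i = (x, y - (\<Prod>i=1..g+1. I i * V i) / y)"
    unfolding Q(2) xy rho_def toda_cm1_eq[OF g] by simp
  show "poly (h1_poly g I V) (fst (P i)) + (- 1) ^ (g + 1) * snd (P i) = 0"
  proof (cases "even g")
    case True
    then show ?thesis unfolding h1_poly_def Pi by (simp only: if_True fst_conv snd_conv poly_toda_poly E) simp
  next
    case False
    then show ?thesis unfolding h1_poly_def Pi by (simp only: if_False fst_conv snd_conv poly_toda_poly E) simp
  qed
  show "(snd (P i))\<^sup>2 = poly (spectral_poly g I V) (fst (P i))"
    unfolding Pi spectral_poly_eq[OF g] poly_diff poly_power poly_toda_poly fst_conv snd_conv E(3)
    by simp
qed

lemma h1_poly_degree:
  assumes "g \<ge> 2"
  shows "degree (h1_poly g I V) \<le> g + 1" and "coeff (h1_poly g I V) (g + 1) = 1"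
  using degree_toda_poly[OF assms] by (simp_all add: h1_poly_def)

text \<open>The point at infinity with coefficient \<open>g\<close> is the one where the leading
  terms of \<open>h1\<close> cancel: \<open>Inf_plus\<close> for even \<open>g\<close>,
  \<open>Inf_minus\<close> for odd \<open>g\<close>.\<close>

lemma lookup_divisor:
  fixes g :: nat
  defines "D \<equiv> frag_of Inf_minus + frag_cmul 2 (D_star g)"
  shows "Poly_Mapping.lookup D (Affine p q) = 0"
    and "Poly_Mapping.lookup D Inf_plus = (if even g then int g else int g + 1)"
    and "Poly_Mapping.lookup D Inf_minus = (if even g then int g + 1 else int g)"
proof -
  show "Poly_Mapping.lookup D (Affine p q) = 0"
    by (simp add: D_def D_star_def lookup_add)
  show "Poly_Mapping.lookup D Inf_plus = (if even g then int g else int g + 1)"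
    by (cases "even g") (auto simp: D_def D_star_def lookup_add elim!: evenE oddE)
  show "Poly_Mapping.lookup D Inf_minus = (if even g then int g + 1 else int g)"
    by (cases "even g") (auto simp: D_def D_star_def lookup_add elim!: evenE oddE)
qed

theorem theorem7:
  fixes g :: nat and I V :: "nat \<Rightarrow> complex" and P :: "nat \<Rightarrow> complex \<times> complex"
    and F :: "complex poly" and A :: "complex \<times> complex"
  defines "F \<equiv> spectral_poly g I V"
    and "A \<equiv> (0, (\<Prod>i=1..g+1. V i) - (\<Prod>i=1..g+1. I i))"
  assumes "g \<ge> 2"
    and "(I, V) \<in> phase_space g"
    and "nonsingular_curve F"
    and "eigenvector_map g I V P"
    and "\<forall>i\<in>{1..g}. fst (P i) \<noteq> 0"
    and "\<forall>i\<in>{1..g}. \<forall>j\<in>{1..g}. i \<noteq> j \<longrightarrow> fst (P i) \<noteq> fst (P j)"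
  shows "{h \<in> L_space g F (frag_of Inf_minus + frag_cmul 2 (D_star g)).
            passes_through g F h A \<and> (\<forall>i\<in>{1..g}. passes_through g F h (P i))}
         = {scale_fun k (h1 g I V) | k. k \<noteq> 0}"
proof -
  note g = \<open>g \<ge> 2\<close>
  define D where "D = frag_of Inf_minus + frag_cmul 2 (D_star g)"
  note lookup = lookup_divisor[of g, folded D_def]
  have F: "lead_coeff F = 1" "nonsingular_curve F" and degF: "degree F > 0"
    using assms spectral_poly_degree[OF g] by auto
  define a0 and \<beta>0 :: complex where "a0 = h1_poly g I V" and "\<beta>0 = (- 1) ^ (g + 1)"
  have \<beta>0: "\<beta>0 * \<beta>0 = 1" "\<beta>0 \<noteq> 0" by (simp_all add: \<beta>0_def flip: power_add mult_2)
  have deg0: "degree a0 \<le> g + 1" "coeff a0 (g + 1) = 1"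
    using h1_poly_degree[OF g] by (simp_all add: a0_def)
  have scale: "scale_fun k (h1 g I V) = (to_fract (Polynomial.smult k a0), to_fract [:k * \<beta>0:])" for k
  proof -
    have "Polynomial.smult k a0 = [:k:] * a0" "[:k * \<beta>0:] = [:k:] * [:\<beta>0:]" by simp_all
    then show ?thesis unfolding h1_eq[OF g] a0_def[symmetric] \<beta>0_def[symmetric]
      by (simp only: scale_fun_def fst_conv snd_conv to_fract_mult)
  qed
  define pts where "pts = insert A (P ` {1..g})"
  have pts: "passes_through g F h A \<and> (\<forall>i\<in>{1..g}. passes_through g F h (P i)) \<longleftrightarrow>
      (\<forall>(p, q)\<in>pts. passes_through g F h (p, q))" for h
    by (auto simp: pts_def)
  have h1_pts: "poly a0 p + \<beta>0 * q = 0 \<and> q\<^sup>2 = poly F p" if "(p, q) \<in> pts" for p q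
  proof (cases "(p, q) = A")
    case True
    then show ?thesis
      using h1_at_A[OF g, where I = I and V = V] by (simp only: A_def prod.inject a0_def \<beta>0_def F_def)
  next
    case False
    then have "(p, q) \<in> P ` {1..g}" using that by (simp add: pts_def)
    then obtain i where i: "i \<in> {1..g}" "(p, q) = P i" by blast
    show ?thesis
      using h1_at_eigenvector_point[OF g \<open>eigenvector_map g I V P\<close> i(1)]
      by (simp only: i(2)[symmetric] fst_conv snd_conv a0_def \<beta>0_def F_def)
  qed
  \<comment> \<open>Generic position makes the first coordinates distinct and nonzero, and
    \<open>A\<close> contributes the coordinate 0.\<close>
  have card_pts: "card (fst ` pts) = g + 1"
  proof -
    have inj: "inj_on (\<lambda>i. fst (P i)) {1..g}" using assms(8) by (auto simp: inj_on_def)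
    have "fst ` pts = insert 0 ((\<lambda>i. fst (P i)) ` {1..g})"
      by (simp add: pts_def A_def image_image)
    moreover have "0 \<notin> (\<lambda>i. fst (P i)) ` {1..g}" using assms(7) by auto
    ultimately show ?thesis using card_image[OF inj] by simp
  qed
  have "h \<in> L_space g F D \<and> (\<forall>(p, q)\<in>pts. passes_through g F h (p, q)) \<longleftrightarrow>
      (\<exists>k. h = scale_fun k (h1 g I V) \<and> k \<noteq> 0)" for h
  proof
    assume h: "h \<in> L_space g F D \<and> (\<forall>(p, q)\<in>pts. passes_through g F h (p, q))"
    then have "passes_through g F h A" using pts by blast
    then have h0: "h \<noteq> (0, 0)" by (simp add: passes_through_def)
    obtain a \<beta> where hab: "h = (to_fract a, to_fract [:\<beta>:])" and deg: "degree a \<le> g + 1"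
      and inf: "Poly_Mapping.lookup D Inf_plus \<le> int g \<Longrightarrow> coeff a (g + 1) + \<beta> = 0"
        "Poly_Mapping.lookup D Inf_minus \<le> int g \<Longrightarrow> coeff a (g + 1) - \<beta> = 0"
      by (rule L_space_affine_linear[OF F, of h g D]) (use h h0 in \<open>auto simp: lookup\<close>)
    \<comment> \<open>Since \<open>\<beta>0\<close> squares to 1, this is the multiple of
      \<open>h1\<close> with the same coefficient of \<open>v\<close>; the pole bound of order
      \<open>g\<close> then matches the top coefficient of \<open>a\<close>.\<close>
    define k where "k = \<beta> * \<beta>0"
    have k: "coeff a (g + 1) = k"
      using inf by (cases "even g") (auto simp: lookup k_def \<beta>0_def add_eq_0_iff)
    have \<beta>: "\<beta> = k * \<beta>0" by (simp add: k_def \<beta>0 mult.assoc)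
    define r where "r = a - Polynomial.smult k a0"
    have "degree r \<le> g"
    proof (rule degree_le, intro allI impI)
      fix j assume "g < j"
      then consider "j = g + 1" | "g + 1 < j" by linarith
      then show "coeff r j = 0"
        by cases (use deg deg0 k in \<open>auto simp: r_def coeff_eq_0\<close>)
    qed
    moreover have "fst ` pts \<subseteq> {x. poly r x = 0}"
    proof safe
      fix p q assume pq: "(p, q) \<in> pts"
      then have "poly a p + \<beta> * q = 0" using h hab passes_through_imp[OF F] by auto
      moreover have "poly a0 p + \<beta>0 * q = 0" using h1_pts[OF pq] by simp
      ultimately have "poly a p = - (\<beta> * q)" "poly a0 p = - (\<beta>0 * q)" by (simp_all add: eq_neg_iff_add_eq_0)
      then show "poly r (fst (p, q)) = 0" by (simp add: r_def \<beta> mult.assoc)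
    qed
    \<comment> \<open>The degree is at most \<open>g\<close>, but there are \<open>g + 1\<close>
      roots.\<close>
    ultimately have "r = 0"
      using card_poly_roots_bound[of r] card_mono[OF poly_roots_finite[of r], of "fst ` pts"] card_pts
      by fastforce
    then have "h = scale_fun k (h1 g I V)" by (simp add: hab scale r_def \<beta>)
    moreover have "k \<noteq> 0" using h0 calculation by (auto simp: scale_fun_def)
    ultimately show "\<exists>k. h = scale_fun k (h1 g I V) \<and> k \<noteq> 0" by blast
  next
    assume "\<exists>k. h = scale_fun k (h1 g I V) \<and> k \<noteq> 0"
    then obtain k where hk: "h = (to_fract (Polynomial.smult k a0), to_fract [:k * \<beta>0:])" and k: "k \<noteq> 0"
      by (auto simp: scale)
    have "h \<in> L_space g F D"
      unfolding hk
    proof (rule affine_linear_in_L_space[OF F])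
      show "degree (Polynomial.smult k a0) \<le> g + 1" using deg0 by simp
    qed (use deg0 in \<open>auto simp: lookup \<beta>0_def\<close>)
    moreover have "passes_through g F h (p, q)" if "(p, q) \<in> pts" for p q
      unfolding hk
    proof (rule passes_throughI[OF F degF])
      show "k * \<beta>0 \<noteq> 0" using k \<beta>0 by simp
      show "q\<^sup>2 = poly F p" using h1_pts[OF that] by simp
      have "poly (Polynomial.smult k a0) p + k * \<beta>0 * q = k * (poly a0 p + \<beta>0 * q)"
        by (simp add: algebra_simps)
      then show "poly (Polynomial.smult k a0) p + k * \<beta>0 * q = 0" using h1_pts[OF that] by simp
    qed
    ultimately show "h \<in> L_space g F D \<and> (\<forall>(p, q)\<in>pts. passes_through g F h (p, q))" by auto
  qed
  then show ?thesis unfolding D_def[symmetric] pts by blast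
qed

end
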